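(* Let $I$ be an object of an elementary topos $\mathcal{E}$. If $I$ is externally injective, then $I$ is also internally injective. Conversely, if $\mathcal{E}$ is localic and Zorn's lemma is available in the metatheory, then every internally injective object $I$ of $\mathcal{E}$ is externally injective.
   Context: An object $I$ of an elementary topos $\mathcal{E}$ is externally injective if and only if for any monomorphism $A \to B$ in $\mathcal{E}$, the canonical map $\mathrm{Hom}_{\mathcal{E}}(B,I) \to \mathrm{Hom}_{\mathcal{E}}(A,I)$ is surjective. It is internally injective if and only if for any monomorphism $A \to B$ in $\mathcal{E}$, the canonical morphism $[B,I] \to [A,I]$ between internal Hom objects (exponentials) is an epimorphism in $\mathcal{E}$. A topos is localic if it is equivalent to the topos $\mathrm{Sh}(X)$ of sheaves of sets on a locale $X$. *)

theory Defs
  imports "HOL-Algebra.Complete_Lattice" "HOL-Library.Equipollence" "HOL-Library.FuncSet"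
begin

section \<open>Categories\<close>

record ('o, 'a) category =
  Obj :: "'o set"
  Arr :: "'a set"
  Dom :: "'a \<Rightarrow> 'o"
  Cod :: "'a \<Rightarrow> 'o"
  Ident :: "'o \<Rightarrow> 'a"
  Comp :: "'a \<Rightarrow> 'a \<Rightarrow> 'a" (infixr \<open>\<cdot>\<index>\<close> 70)

definition Hom :: "('o, 'a) category \<Rightarrow> 'o \<Rightarrow> 'o \<Rightarrow> 'a set" where
  "Hom C A B = {f \<in> Arr C. Dom C f = A \<and> Cod C f = B}"

locale category =
  fixes C :: "('o, 'a) category" (structure)
  assumes Dom_in_Obj: "f \<in> Arr C \<Longrightarrow> Dom C f \<in> Obj C"
    and Cod_in_Obj: "f \<in> Arr C \<Longrightarrow> Cod C f \<in> Obj C"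
    and Ident_in_Hom: "A \<in> Obj C \<Longrightarrow> Ident C A \<in> Hom C A A"
    and Comp_in_Hom: "f \<in> Hom C A B \<Longrightarrow> g \<in> Hom C B D \<Longrightarrow> g \<cdot> f \<in> Hom C A D"
    and Comp_Ident_right: "f \<in> Hom C A B \<Longrightarrow> f \<cdot> Ident C A = f"
    and Comp_Ident_left: "f \<in> Hom C A B \<Longrightarrow> Ident C B \<cdot> f = f"
    and Comp_assoc:
      "f \<in> Hom C A B \<Longrightarrow> g \<in> Hom C B D \<Longrightarrow> h \<in> Hom C D E \<Longrightarrow>
        (h \<cdot> g) \<cdot> f = h \<cdot> (g \<cdot> f)"

definition monomorphism :: "('o, 'a) category \<Rightarrow> 'a \<Rightarrow> bool" where
  "monomorphism C m \<longleftrightarrow> m \<in> Arr C \<and>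
    (\<forall>Z \<in> Obj C. \<forall>f \<in> Hom C Z (Dom C m). \<forall>g \<in> Hom C Z (Dom C m).
      m \<cdot>\<^bsub>C\<^esub> f = m \<cdot>\<^bsub>C\<^esub> g \<longrightarrow> f = g)"

definition epimorphism :: "('o, 'a) category \<Rightarrow> 'a \<Rightarrow> bool" where
  "epimorphism C e \<longleftrightarrow> e \<in> Arr C \<and>
    (\<forall>Z \<in> Obj C. \<forall>f \<in> Hom C (Cod C e) Z. \<forall>g \<in> Hom C (Cod C e) Z.
      f \<cdot>\<^bsub>C\<^esub> e = g \<cdot>\<^bsub>C\<^esub> e \<longrightarrow> f = g)"

definition isomorphism :: "('o, 'a) category \<Rightarrow> 'a \<Rightarrow> bool" where
  "isomorphism C f \<longleftrightarrow> f \<in> Arr C \<and>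
    (\<exists>g \<in> Hom C (Cod C f) (Dom C f).
      g \<cdot>\<^bsub>C\<^esub> f = Ident C (Dom C f) \<and> f \<cdot>\<^bsub>C\<^esub> g = Ident C (Cod C f))"


section \<open>Limits\<close>

definition is_terminal :: "('o, 'a) category \<Rightarrow> 'o \<Rightarrow> bool" where
  "is_terminal C T \<longleftrightarrow> T \<in> Obj C \<and> (\<forall>A \<in> Obj C. \<exists>!f. f \<in> Hom C A T)"

definition is_product :: "('o, 'a) category \<Rightarrow> 'o \<Rightarrow> 'o \<Rightarrow> 'a \<Rightarrow> 'a \<Rightarrow> bool" where
  "is_product C A B p q \<longleftrightarrow>
    p \<in> Hom C (Dom C p) A \<and> q \<in> Hom C (Dom C p) B \<and>
    (\<forall>Z \<in> Obj C. \<forall>f \<in> Hom C Z A. \<forall>g \<in> Hom C Z B.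
      \<exists>!h. h \<in> Hom C Z (Dom C p) \<and> p \<cdot>\<^bsub>C\<^esub> h = f \<and> q \<cdot>\<^bsub>C\<^esub> h = g)"

definition is_equalizer :: "('o, 'a) category \<Rightarrow> 'a \<Rightarrow> 'a \<Rightarrow> 'a \<Rightarrow> bool" where
  "is_equalizer C f g e \<longleftrightarrow>
    e \<in> Hom C (Dom C e) (Dom C f) \<and> f \<cdot>\<^bsub>C\<^esub> e = g \<cdot>\<^bsub>C\<^esub> e \<and>
    (\<forall>Z \<in> Obj C. \<forall>h \<in> Hom C Z (Dom C f). f \<cdot>\<^bsub>C\<^esub> h = g \<cdot>\<^bsub>C\<^esub> h \<longrightarrow>
      (\<exists>!u. u \<in> Hom C Z (Dom C e) \<and> e \<cdot>\<^bsub>C\<^esub> u = h))"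

definition is_pullback :: "('o, 'a) category \<Rightarrow> 'a \<Rightarrow> 'a \<Rightarrow> 'a \<Rightarrow> 'a \<Rightarrow> bool" where
  "is_pullback C f g p q \<longleftrightarrow>
    p \<in> Hom C (Dom C p) (Dom C f) \<and> q \<in> Hom C (Dom C p) (Dom C g) \<and>
    f \<cdot>\<^bsub>C\<^esub> p = g \<cdot>\<^bsub>C\<^esub> q \<and>
    (\<forall>Z \<in> Obj C. \<forall>h \<in> Hom C Z (Dom C f). \<forall>k \<in> Hom C Z (Dom C g).
      f \<cdot>\<^bsub>C\<^esub> h = g \<cdot>\<^bsub>C\<^esub> k \<longrightarrow>
      (\<exists>!u. u \<in> Hom C Z (Dom C p) \<and> p \<cdot>\<^bsub>C\<^esub> u = h \<and> q \<cdot>\<^bsub>C\<^esub> u = k))"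

text \<open>Finite limits, in the usual form of a terminal object, binary products and equalizers.\<close>

definition has_finite_limits :: "('o, 'a) category \<Rightarrow> bool" where
  "has_finite_limits C \<longleftrightarrow>
    (\<exists>T. is_terminal C T) \<and>
    (\<forall>A \<in> Obj C. \<forall>B \<in> Obj C. \<exists>p q. is_product C A B p q) \<and>
    (\<forall>A \<in> Obj C. \<forall>B \<in> Obj C. \<forall>f \<in> Hom C A B. \<forall>g \<in> Hom C A B. \<exists>e. is_equalizer C f g e)"

text \<open>
  In a category with binary products we choose a product cone for each pair of objects;
  the constants below are meaningful only when such cones exist.
\<close>

definition product_cone :: "('o, 'a) category \<Rightarrow> 'o \<Rightarrow> 'o \<Rightarrow> 'a \<times> 'a" where
  "product_cone C A B = (SOME pq. is_product C A B (fst pq) (snd pq))"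

definition Fst :: "('o, 'a) category \<Rightarrow> 'o \<Rightarrow> 'o \<Rightarrow> 'a" where
  "Fst C A B = fst (product_cone C A B)"

definition Snd :: "('o, 'a) category \<Rightarrow> 'o \<Rightarrow> 'o \<Rightarrow> 'a" where
  "Snd C A B = snd (product_cone C A B)"

definition Prod :: "('o, 'a) category \<Rightarrow> 'o \<Rightarrow> 'o \<Rightarrow> 'o" where
  "Prod C A B = Dom C (Fst C A B)"

definition Pairing :: "('o, 'a) category \<Rightarrow> 'a \<Rightarrow> 'a \<Rightarrow> 'a" where
  "Pairing C f g = (THE h. h \<in> Hom C (Dom C f) (Prod C (Cod C f) (Cod C g)) \<and>
    Fst C (Cod C f) (Cod C g) \<cdot>\<^bsub>C\<^esub> h = f \<and> Snd C (Cod C f) (Cod C g) \<cdot>\<^bsub>C\<^esub> h = g)"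

definition Prod_map :: "('o, 'a) category \<Rightarrow> 'a \<Rightarrow> 'a \<Rightarrow> 'a" where
  "Prod_map C f g = Pairing C
    (f \<cdot>\<^bsub>C\<^esub> Fst C (Dom C f) (Dom C g)) (g \<cdot>\<^bsub>C\<^esub> Snd C (Dom C f) (Dom C g))"


section \<open>Internal homs\<close>

text \<open>\<open>E\<close> with evaluation \<open>ev : E \<times> A \<rightarrow> I\<close> is an internal hom \<open>[A, I]\<close>.\<close>

definition is_exponential :: "('o, 'a) category \<Rightarrow> 'o \<Rightarrow> 'o \<Rightarrow> 'o \<Rightarrow> 'a \<Rightarrow> bool" where
  "is_exponential C A I E ev \<longleftrightarrow>
    E \<in> Obj C \<and> ev \<in> Hom C (Prod C E A) I \<and>
    (\<forall>Z \<in> Obj C. \<forall>f \<in> Hom C (Prod C Z A) I.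
      \<exists>!g. g \<in> Hom C Z E \<and> ev \<cdot>\<^bsub>C\<^esub> Prod_map C g (Ident C A) = f)"

definition has_exponentials :: "('o, 'a) category \<Rightarrow> bool" where
  "has_exponentials C \<longleftrightarrow> (\<forall>A \<in> Obj C. \<forall>I \<in> Obj C. \<exists>E ev. is_exponential C A I E ev)"

definition exponential_cone :: "('o, 'a) category \<Rightarrow> 'o \<Rightarrow> 'o \<Rightarrow> 'o \<times> 'a" where
  "exponential_cone C A I = (SOME x. is_exponential C A I (fst x) (snd x))"

definition Exp :: "('o, 'a) category \<Rightarrow> 'o \<Rightarrow> 'o \<Rightarrow> 'o" where
  "Exp C A I = fst (exponential_cone C A I)"

definition Eval :: "('o, 'a) category \<Rightarrow> 'o \<Rightarrow> 'o \<Rightarrow> 'a" where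
  "Eval C A I = snd (exponential_cone C A I)"

definition Curry :: "('o, 'a) category \<Rightarrow> 'o \<Rightarrow> 'o \<Rightarrow> 'o \<Rightarrow> 'a \<Rightarrow> 'a" where
  "Curry C Z A I f = (THE g. g \<in> Hom C Z (Exp C A I) \<and>
    Eval C A I \<cdot>\<^bsub>C\<^esub> Prod_map C g (Ident C A) = f)"

text \<open>
  The canonical morphism \<open>[B, I] \<rightarrow> [A, I]\<close> induced by \<open>m : A \<rightarrow> B\<close>, i.e. the transpose of
  \<open>[B, I] \<times> A \<rightarrow> [B, I] \<times> B \<rightarrow> I\<close>.
\<close>

definition Exp_precomp :: "('o, 'a) category \<Rightarrow> 'a \<Rightarrow> 'o \<Rightarrow> 'a" where
  "Exp_precomp C m I = Curry C (Exp C (Cod C m) I) (Dom C m) I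
    (Eval C (Cod C m) I \<cdot>\<^bsub>C\<^esub> Prod_map C (Ident C (Exp C (Cod C m) I)) m)"


section \<open>Elementary toposes and injective objects\<close>

definition is_subobject_classifier :: "('o, 'a) category \<Rightarrow> 'a \<Rightarrow> bool" where
  "is_subobject_classifier C t \<longleftrightarrow>
    t \<in> Arr C \<and> is_terminal C (Dom C t) \<and>
    (\<forall>m. monomorphism C m \<longrightarrow>
      (\<exists>!\<chi>. \<chi> \<in> Hom C (Cod C m) (Cod C t) \<and> (\<exists>u. is_pullback C \<chi> t m u)))"

locale elementary_topos = category C for C :: "('o, 'a) category" (structure) +
  assumes finite_limits: "has_finite_limits C"
    and exponentials: "has_exponentials C"
    and subobject_classifier: "\<exists>t. is_subobject_classifier C t"

definition externally_injective :: "('o, 'a) category \<Rightarrow> 'o \<Rightarrow> bool" where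
  "externally_injective C I \<longleftrightarrow> I \<in> Obj C \<and>
    (\<forall>m. monomorphism C m \<longrightarrow>
      (\<lambda>g. g \<cdot>\<^bsub>C\<^esub> m) ` Hom C (Cod C m) I = Hom C (Dom C m) I)"

definition internally_injective :: "('o, 'a) category \<Rightarrow> 'o \<Rightarrow> bool" where
  "internally_injective C I \<longleftrightarrow> I \<in> Obj C \<and>
    (\<forall>m. monomorphism C m \<longrightarrow> epimorphism C (Exp_precomp C m I))"


section \<open>Equivalence of categories\<close>

text \<open>A functor is given by its object part and its arrow part.\<close>

definition is_functor ::
  "('o, 'a) category \<Rightarrow> ('p, 'b) category \<Rightarrow> ('o \<Rightarrow> 'p) \<Rightarrow> ('a \<Rightarrow> 'b) \<Rightarrow> bool" where
  "is_functor C D F0 F1 \<longleftrightarrow>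
    (\<forall>A \<in> Obj C. F0 A \<in> Obj D \<and> F1 (Ident C A) = Ident D (F0 A)) \<and>
    (\<forall>f \<in> Arr C. F1 f \<in> Hom D (F0 (Dom C f)) (F0 (Cod C f))) \<and>
    (\<forall>f \<in> Arr C. \<forall>g \<in> Arr C. Dom C g = Cod C f \<longrightarrow> F1 (g \<cdot>\<^bsub>C\<^esub> f) = F1 g \<cdot>\<^bsub>D\<^esub> F1 f)"

definition naturally_isomorphic ::
  "('o, 'a) category \<Rightarrow> ('p, 'b) category \<Rightarrow>
    ('o \<Rightarrow> 'p) \<Rightarrow> ('a \<Rightarrow> 'b) \<Rightarrow> ('o \<Rightarrow> 'p) \<Rightarrow> ('a \<Rightarrow> 'b) \<Rightarrow> bool" where
  "naturally_isomorphic C D F0 F1 G0 G1 \<longleftrightarrow>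
    (\<exists>\<tau>. (\<forall>A \<in> Obj C. \<tau> A \<in> Hom D (F0 A) (G0 A) \<and> isomorphism D (\<tau> A)) \<and>
      (\<forall>f \<in> Arr C. \<tau> (Cod C f) \<cdot>\<^bsub>D\<^esub> F1 f = G1 f \<cdot>\<^bsub>D\<^esub> \<tau> (Dom C f)))"

definition equivalent_categories :: "('o, 'a) category \<Rightarrow> ('p, 'b) category \<Rightarrow> bool" where
  "equivalent_categories C D \<longleftrightarrow>
    (\<exists>F0 F1 G0 G1. is_functor C D F0 F1 \<and> is_functor D C G0 G1 \<and>
      naturally_isomorphic C C (G0 \<circ> F0) (G1 \<circ> F1) id id \<and>
      naturally_isomorphic D D (F0 \<circ> G0) (F1 \<circ> G1) id id)"


section \<open>Locales and sheaves\<close>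

text \<open>
  A locale (generalized space) \<open>X\<close> is represented by its frame of opens.
\<close>

locale frame = complete_lattice X for X :: "'u gorder" (structure) +
  assumes meet_Sup_distrib:
    "U \<in> carrier X \<Longrightarrow> S \<subseteq> carrier X \<Longrightarrow> U \<sqinter> (\<Squnion> S) = \<Squnion> ((\<lambda>V. U \<sqinter> V) ` S)"

text \<open>
  There is no category of all sets in HOL: the subsets of an infinite type are not closed under
  powersets up to bijection.  Sheaves therefore take values in a Grothendieck universe \<open>\<U>\<close> of
  small sets with elements in \<open>'u\<close>, closed under the set formation operations up to bijection.
  The case where \<open>\<U>\<close> consists of the finite subsets of an infinite type
  is not excluded.
\<close>

locale set_universe =
  fixes \<U> :: "'u set set"
  assumes nonempty: "\<U> \<noteq> {}"
    and subset_closed: "A \<in> \<U> \<Longrightarrow> B \<subseteq> A \<Longrightarrow> B \<in> \<U>"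
    and image_closed: "A \<in> \<U> \<Longrightarrow> f ` A \<in> \<U>"
    and Union_closed: "A \<in> \<U> \<Longrightarrow> (\<And>a. a \<in> A \<Longrightarrow> F a \<in> \<U>) \<Longrightarrow> (\<Union>a \<in> A. F a) \<in> \<U>"
    and Pow_closed: "A \<in> \<U> \<Longrightarrow> \<exists>B \<in> \<U>. B \<approx> Pow A"

text \<open>
  \<open>restrict F U V : F(U) \<rightarrow> F(V)\<close> is the restriction map for \<open>V \<le> U\<close>.  The values of the two
  components outside these domains are junk; presheaves that differ only there are distinct but
  isomorphic objects.
\<close>

record 'u presheaf_data =
  sections :: "'u \<Rightarrow> 'u set"
  restriction :: "'u \<Rightarrow> 'u \<Rightarrow> 'u \<Rightarrow> 'u"

definition is_presheaf :: "'u set set \<Rightarrow> 'u gorder \<Rightarrow> 'u presheaf_data \<Rightarrow> bool" where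
  "is_presheaf \<U> X F \<longleftrightarrow>
    (\<forall>U \<in> carrier X. sections F U \<in> \<U>) \<and>
    (\<forall>U \<in> carrier X. \<forall>V \<in> carrier X. V \<sqsubseteq>\<^bsub>X\<^esub> U \<longrightarrow>
      restriction F U V \<in> sections F U \<rightarrow> sections F V) \<and>
    (\<forall>U \<in> carrier X. \<forall>s \<in> sections F U. restriction F U U s = s) \<and>
    (\<forall>U \<in> carrier X. \<forall>V \<in> carrier X. \<forall>W \<in> carrier X. W \<sqsubseteq>\<^bsub>X\<^esub> V \<longrightarrow> V \<sqsubseteq>\<^bsub>X\<^esub> U \<longrightarrow>
      (\<forall>s \<in> sections F U. restriction F V W (restriction F U V s) = restriction F U W s))"

definition is_sheaf :: "'u set set \<Rightarrow> 'u gorder \<Rightarrow> 'u presheaf_data \<Rightarrow> bool" where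
  "is_sheaf \<U> X F \<longleftrightarrow> is_presheaf \<U> X F \<and>
    (\<forall>S s. S \<subseteq> carrier X \<longrightarrow> (\<forall>V \<in> S. s V \<in> sections F V) \<longrightarrow>
      (\<forall>V \<in> S. \<forall>W \<in> S.
        restriction F V (V \<sqinter>\<^bsub>X\<^esub> W) (s V) = restriction F W (V \<sqinter>\<^bsub>X\<^esub> W) (s W)) \<longrightarrow>
      (\<exists>!t. t \<in> sections F (\<Squnion>\<^bsub>X\<^esub> S) \<and> (\<forall>V \<in> S. restriction F (\<Squnion>\<^bsub>X\<^esub> S) V t = s V)))"

record 'u sheaf_morphism =
  source :: "'u presheaf_data"
  target :: "'u presheaf_data"
  component :: "'u \<Rightarrow> 'u \<Rightarrow> 'u"

text \<open>
  The components are extensional functions, so that morphisms are equal as soon as they agree on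
  all sections over all opens.
\<close>

definition is_sheaf_morphism :: "'u set set \<Rightarrow> 'u gorder \<Rightarrow> 'u sheaf_morphism \<Rightarrow> bool" where
  "is_sheaf_morphism \<U> X \<eta> \<longleftrightarrow>
    is_sheaf \<U> X (source \<eta>) \<and> is_sheaf \<U> X (target \<eta>) \<and>
    component \<eta> \<in> (\<Pi>\<^sub>E U \<in> carrier X. sections (source \<eta>) U \<rightarrow>\<^sub>E sections (target \<eta>) U) \<and>
    (\<forall>U \<in> carrier X. \<forall>V \<in> carrier X. V \<sqsubseteq>\<^bsub>X\<^esub> U \<longrightarrow>
      (\<forall>s \<in> sections (source \<eta>) U.
        component \<eta> V (restriction (source \<eta>) U V s) =
        restriction (target \<eta>) U V (component \<eta> U s)))"

definition Sh :: "'u set set \<Rightarrow> 'u gorder \<Rightarrow> ('u presheaf_data, 'u sheaf_morphism) category" where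
  "Sh \<U> X = \<lparr>
    Obj = {F. is_sheaf \<U> X F},
    Arr = {\<eta>. is_sheaf_morphism \<U> X \<eta>},
    Dom = source,
    Cod = target,
    Ident = (\<lambda>F. \<lparr>source = F, target = F,
      component = (\<lambda>U \<in> carrier X. \<lambda>s \<in> sections F U. s)\<rparr>),
    Comp = (\<lambda>\<eta> \<theta>. \<lparr>source = source \<theta>, target = target \<eta>,
      component = (\<lambda>U \<in> carrier X. \<lambda>s \<in> sections (source \<theta>) U.
        component \<eta> U (component \<theta> U s))\<rparr>)\<rparr>"

text \<open>
  The locale \<open>X\<close> is required to be small; since \<open>\<U>\<close> is closed under bijections within \<open>'u\<close>, we
  may take its opens to be elements of \<open>'u\<close>.
\<close>

definition localic :: "'u set set \<Rightarrow> ('o, 'a) category \<Rightarrow> bool" where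
  "localic \<U> C \<longleftrightarrow>
    (\<exists>X :: 'u gorder. frame X \<and> carrier X \<in> \<U> \<and> equivalent_categories C (Sh \<U> X))"

end

theory Submission
  imports Defs
begin

text \<open>
  One direction is formal. If \<open>I\<close> is externally injective and \<open>m : A \<rightarrow> B\<close> is a monomorphism, then so is
  \<open>[A, I] \<times> A \<rightarrow> [A, I] \<times> B\<close>, hence evaluation \<open>[A, I] \<times> A \<rightarrow> I\<close> extends to \<open>[A, I] \<times> B \<rightarrow> I\<close>. The
  transpose of this extension is a section of \<open>[B, I] \<rightarrow> [A, I]\<close>, which is therefore a split
  epimorphism (\<open>externally_injective_imp_internally_injective\<close>).

  For the converse, internal injectivity says that a morphism \<open>f : A \<rightarrow> I\<close> can be extended
  locally along a monomorphism, and Zorn's lemma turns local extensions into a global one. The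
  canonical morphism \<open>[B, I] \<rightarrow> [A, I]\<close> is defined from chosen products and internal homs, so internal
  injectivity is first replaced by a consequence that mentions neither: there is an epimorphism \<open>e\<close> such
  that every lift of the name of \<open>f\<close> through \<open>e\<close>, at any stage, yields an extension of \<open>f\<close> at
  that stage (\<open>extends_over_epis\<close>). This property is stable under equivalence of categories, so it
  may be used in \<open>Sh(X)\<close>.

  In \<open>Sh(X)\<close>, comparing two maps into the sheaf of truth values shows that epimorphisms are locally
  surjective (\<open>epi_locally_surjective\<close>). Hence opens \<open>V\<close> over which \<open>f\<close> extends to all of \<open>B\<close> cover
  the top element. Now consider partial maps from \<open>B\<close> to \<open>J\<close>, where \<open>J\<close> corresponds to \<open>I\<close>: functional
  relations that are closed under restriction. Unions of chains of such relations are again such relations,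
  so the graph of \<open>f\<close> lies in a maximal one. By maximality it is closed under glueing, and its domain
  \<open>A'\<close> is a subsheaf of \<open>B\<close>. Applying local extendability to \<open>A' \<rightarrow> B\<close> gives, for the opens \<open>V\<close> of some
  cover, maps on \<open>B|V\<close> that agree with the partial map where both are defined. Joining such a
  map to the partial map cannot enlarge it, so \<open>B|V\<close> is contained in \<open>A'\<close> for all
  these \<open>V\<close>. As \<open>A'\<close> is a subsheaf and the \<open>V\<close> form a cover, \<open>A' = B\<close>
  (\<open>extends_over_epis_imp_extends\<close>).
\<close>

section \<open>Products and internal homs\<close>

context category
begin

lemma Hom_Obj: "f \<in> Hom C A B \<Longrightarrow> A \<in> Obj C" "f \<in> Hom C A B \<Longrightarrow> B \<in> Obj C"
  using Dom_in_Obj Cod_in_Obj unfolding Hom_def by auto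

lemma Comp_typing:
  assumes "f \<in> Arr C" "g \<in> Arr C" "Dom C g = Cod C f"
  shows "g \<cdot> f \<in> Arr C" "Dom C (g \<cdot> f) = Dom C f" "Cod C (g \<cdot> f) = Cod C g"
  using Comp_in_Hom[of f "Dom C f" "Cod C f" g "Cod C g"] assms by (auto simp: Hom_def)

lemma Comp_reassoc:
  assumes "f \<in> Arr C" "g \<in> Arr C" "h \<in> Arr C" "Dom C g = Cod C f" "Dom C h = Cod C g"
  shows "(h \<cdot> g) \<cdot> f = h \<cdot> (g \<cdot> f)"
  using Comp_assoc[of f "Dom C f" "Cod C f" g "Cod C g" h "Cod C h"] assms by (auto simp: Hom_def)

lemmas arrow_simps = Hom_def Comp_typing Comp_reassoc

lemma epimorphismD:
  assumes "epimorphism C e" "e \<in> Hom C P Q" "u \<in> Hom C Q Z" "v \<in> Hom C Q Z" "u \<cdot> e = v \<cdot> e"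
  shows "u = v"
  using assms Hom_Obj(2)[OF assms(3)] unfolding epimorphism_def by (auto simp: Hom_def)

lemma monomorphismD:
  assumes "monomorphism C m" "m \<in> Hom C A B" "u \<in> Hom C Z A" "v \<in> Hom C Z A" "m \<cdot> u = m \<cdot> v"
  shows "u = v"
  using assms Hom_Obj(1)[OF assms(3)] unfolding monomorphism_def by (auto simp: Hom_def)

lemma epimorphismI:
  assumes "e \<in> Hom C P Q"
    and "\<And>Z u v. u \<in> Hom C Q Z \<Longrightarrow> v \<in> Hom C Q Z \<Longrightarrow> u \<cdot> e = v \<cdot> e \<Longrightarrow> u = v"
  shows "epimorphism C e"
  using assms unfolding epimorphism_def by (auto simp: Hom_def)

lemma monomorphismI:
  assumes "m \<in> Hom C A B"
    and "\<And>Z u v. u \<in> Hom C Z A \<Longrightarrow> v \<in> Hom C Z A \<Longrightarrow> m \<cdot> u = m \<cdot> v \<Longrightarrow> u = v"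
  shows "monomorphism C m"
  using assms unfolding monomorphism_def by (auto simp: Hom_def)

lemma split_epimorphism:
  assumes e: "e \<in> Hom C P Q" and s: "s \<in> Hom C Q P" and es: "e \<cdot> s = Ident C Q"
  shows "epimorphism C e"
proof (rule epimorphismI[OF e])
  fix Z u v assume u: "u \<in> Hom C Q Z" and v: "v \<in> Hom C Q Z" and uv: "u \<cdot> e = v \<cdot> e"
  have "u \<cdot> (e \<cdot> s) = v \<cdot> (e \<cdot> s)"
    using uv Comp_assoc[OF s e u] Comp_assoc[OF s e v] by simp
  then show "u = v" using es Comp_Ident_right[OF u] Comp_Ident_right[OF v] by simp
qed

end

context elementary_topos
begin

lemma product_cone_is_product:
  assumes "A \<in> Obj C" "B \<in> Obj C"
  shows "is_product C A B (Fst C A B) (Snd C A B)"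
proof -
  obtain p q where "is_product C A B p q"
    using finite_limits assms unfolding has_finite_limits_def by blast
  then have "\<exists>pq. is_product C A B (fst pq) (snd pq)"
    by (intro exI[of _ "(p, q)"]) simp
  then show ?thesis
    unfolding Fst_def Snd_def product_cone_def by (rule someI_ex)
qed

lemma Fst_in_Hom: "A \<in> Obj C \<Longrightarrow> B \<in> Obj C \<Longrightarrow> Fst C A B \<in> Hom C (Prod C A B) A"
  and Snd_in_Hom: "A \<in> Obj C \<Longrightarrow> B \<in> Obj C \<Longrightarrow> Snd C A B \<in> Hom C (Prod C A B) B"
  using product_cone_is_product[of A B] unfolding is_product_def Prod_def by auto

lemma product_universal:
  assumes "f \<in> Hom C Z A" "g \<in> Hom C Z B"
  shows "\<exists>!h. h \<in> Hom C Z (Prod C A B) \<and> Fst C A B \<cdot> h = f \<and> Snd C A B \<cdot> h = g"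
proof -
  have "A \<in> Obj C" "B \<in> Obj C" "Z \<in> Obj C" using assms Hom_Obj by auto
  then show ?thesis
    using product_cone_is_product[of A B] assms unfolding is_product_def Prod_def by blast
qed

lemma Pairing_props:
  assumes "f \<in> Hom C Z A" "g \<in> Hom C Z B"
  shows Pairing_in_Hom: "Pairing C f g \<in> Hom C Z (Prod C A B)"
    and Fst_Pairing: "Fst C A B \<cdot> Pairing C f g = f"
    and Snd_Pairing: "Snd C A B \<cdot> Pairing C f g = g"
proof -
  have eq: "Dom C f = Z" "Cod C f = A" "Cod C g = B" using assms by (auto simp: Hom_def)
  show "Pairing C f g \<in> Hom C Z (Prod C A B)" "Fst C A B \<cdot> Pairing C f g = f"
    "Snd C A B \<cdot> Pairing C f g = g"
    using theI'[OF product_universal[OF assms]] unfolding Pairing_def eq by auto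
qed

lemma Pairing_unique:
  assumes "f \<in> Hom C Z A" "g \<in> Hom C Z B" "h \<in> Hom C Z (Prod C A B)"
    and "Fst C A B \<cdot> h = f" "Snd C A B \<cdot> h = g"
  shows "h = Pairing C f g"
  using product_universal[OF assms(1,2)] assms Pairing_props[OF assms(1,2)] by blast

lemma Pairing_Comp:
  assumes f: "f \<in> Hom C Z A" and g: "g \<in> Hom C Z B" and h: "h \<in> Hom C Y Z"
  shows "Pairing C f g \<cdot> h = Pairing C (f \<cdot> h) (g \<cdot> h)"
proof -
  have AB: "A \<in> Obj C" "B \<in> Obj C" using f g Hom_Obj by auto
  show ?thesis
    using Pairing_unique[OF Comp_in_Hom[OF h f] Comp_in_Hom[OF h g]
        Comp_in_Hom[OF h Pairing_in_Hom[OF f g]]]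
      Comp_assoc[OF h Pairing_in_Hom[OF f g] Fst_in_Hom[OF AB]]
      Comp_assoc[OF h Pairing_in_Hom[OF f g] Snd_in_Hom[OF AB]]
      Fst_Pairing[OF f g] Snd_Pairing[OF f g] by simp
qed

lemma Prod_map_in_Hom:
  assumes f: "f \<in> Hom C A A'" and g: "g \<in> Hom C B B'"
  shows "Prod_map C f g \<in> Hom C (Prod C A B) (Prod C A' B')"
proof -
  have AB: "A \<in> Obj C" "B \<in> Obj C" using f g Hom_Obj by auto
  have "Dom C f = A" "Dom C g = B" using f g by (auto simp: Hom_def)
  then show ?thesis unfolding Prod_map_def
    using Pairing_in_Hom[OF Comp_in_Hom[OF Fst_in_Hom[OF AB] f] Comp_in_Hom[OF Snd_in_Hom[OF AB] g]]
    by simp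
qed

lemma Prod_map_Pairing:
  assumes f: "f \<in> Hom C A A'" and g: "g \<in> Hom C B B'"
    and u: "u \<in> Hom C Z A" and v: "v \<in> Hom C Z B"
  shows "Prod_map C f g \<cdot> Pairing C u v = Pairing C (f \<cdot> u) (g \<cdot> v)"
proof -
  have AB: "A \<in> Obj C" "B \<in> Obj C" using f g Hom_Obj by auto
  note p = Fst_in_Hom[OF AB] and q = Snd_in_Hom[OF AB] and uv = Pairing_in_Hom[OF u v]
  have "Dom C f = A" "Dom C g = B" using f g by (auto simp: Hom_def)
  then have "Prod_map C f g \<cdot> Pairing C u v
      = Pairing C ((f \<cdot> Fst C A B) \<cdot> Pairing C u v) ((g \<cdot> Snd C A B) \<cdot> Pairing C u v)"
    unfolding Prod_map_def using Pairing_Comp[OF Comp_in_Hom[OF p f] Comp_in_Hom[OF q g] uv] by simp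
  then show ?thesis
    using Comp_assoc[OF uv p f] Comp_assoc[OF uv q g] Fst_Pairing[OF u v] Snd_Pairing[OF u v] by simp
qed

lemma Pairing_Fst_Snd:
  assumes "h \<in> Hom C Z (Prod C A B)" "A \<in> Obj C" "B \<in> Obj C"
  shows "Pairing C (Fst C A B \<cdot> h) (Snd C A B \<cdot> h) = h"
  using Pairing_unique[OF Comp_in_Hom[OF assms(1) Fst_in_Hom] Comp_in_Hom[OF assms(1) Snd_in_Hom]
      assms(1)] assms(2,3) by simp

lemma Prod_map_Ident:
  assumes "A \<in> Obj C" "B \<in> Obj C"
  shows "Prod_map C (Ident C A) (Ident C B) = Ident C (Prod C A B)"
proof -
  note i = Ident_in_Hom[OF assms(1)] Ident_in_Hom[OF assms(2)]
  note p = Fst_in_Hom[OF assms] and q = Snd_in_Hom[OF assms]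
  have P: "Prod C A B \<in> Obj C" using p Hom_Obj by auto
  have d: "Dom C (Ident C A) = A" "Dom C (Ident C B) = B" using i by (auto simp: Hom_def)
  show ?thesis unfolding Prod_map_def d
    using Pairing_Fst_Snd[OF Ident_in_Hom[OF P] assms] Comp_Ident_left[OF p] Comp_Ident_left[OF q]
      Comp_Ident_right[OF p] Comp_Ident_right[OF q] by simp
qed

text \<open>
  A morphism into a product is determined by its components; the first is left unchanged by
  \<open>Ident A \<times> m\<close>, and \<open>m\<close> can be cancelled from the second.
\<close>

lemma Prod_map_mono:
  assumes A: "A \<in> Obj C" and m: "m \<in> Hom C B B'" and mono: "monomorphism C m"
  shows "monomorphism C (Prod_map C (Ident C A) m)"
proof (rule monomorphismI[OF Prod_map_in_Hom[OF Ident_in_Hom[OF A] m]])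
  have B: "B \<in> Obj C" "B' \<in> Obj C" using m Hom_Obj by auto
  note p = Fst_in_Hom[OF A B(1)] and q = Snd_in_Hom[OF A B(1)]
  fix Z u v
  assume u: "u \<in> Hom C Z (Prod C A B)" and v: "v \<in> Hom C Z (Prod C A B)"
    and eq: "Prod_map C (Ident C A) m \<cdot> u = Prod_map C (Ident C A) m \<cdot> v"
  have *: "Fst C A B' \<cdot> (Prod_map C (Ident C A) m \<cdot> w) = Fst C A B \<cdot> w
      \<and> Snd C A B' \<cdot> (Prod_map C (Ident C A) m \<cdot> w) = m \<cdot> (Snd C A B \<cdot> w)"
    if w: "w \<in> Hom C Z (Prod C A B)" for w
  proof -
    note pw = Comp_in_Hom[OF w p] and qw = Comp_in_Hom[OF w q]
    have "Prod_map C (Ident C A) m \<cdot> w = Pairing C (Fst C A B \<cdot> w) (m \<cdot> (Snd C A B \<cdot> w))"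
      using Prod_map_Pairing[OF Ident_in_Hom[OF A] m pw qw] Pairing_Fst_Snd[OF w A B(1)]
        Comp_Ident_left[OF pw] by simp
    then show ?thesis using Pairing_props[OF pw Comp_in_Hom[OF qw m]] by simp
  qed
  have "Fst C A B \<cdot> u = Fst C A B \<cdot> v" using *[OF u] *[OF v] eq by simp
  moreover have "Snd C A B \<cdot> u = Snd C A B \<cdot> v"
    using *[OF u] *[OF v] eq monomorphismD[OF mono m Comp_in_Hom[OF u q] Comp_in_Hom[OF v q]] by simp
  ultimately show "u = v" using Pairing_Fst_Snd[OF u A B(1)] Pairing_Fst_Snd[OF v A B(1)] by metis
qed

lemma exponential_cone_is_exponential:
  assumes "A \<in> Obj C" "I \<in> Obj C"
  shows "is_exponential C A I (Exp C A I) (Eval C A I)"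
proof -
  obtain E ev where "is_exponential C A I E ev"
    using exponentials assms unfolding has_exponentials_def by blast
  then have "\<exists>x. is_exponential C A I (fst x) (snd x)"
    by (intro exI[of _ "(E, ev)"]) simp
  then show ?thesis
    unfolding Exp_def Eval_def exponential_cone_def by (rule someI_ex)
qed

lemma Exp_Obj: "A \<in> Obj C \<Longrightarrow> I \<in> Obj C \<Longrightarrow> Exp C A I \<in> Obj C"
  and Eval_in_Hom: "A \<in> Obj C \<Longrightarrow> I \<in> Obj C \<Longrightarrow> Eval C A I \<in> Hom C (Prod C (Exp C A I) A) I"
  using exponential_cone_is_exponential[of A I] unfolding is_exponential_def by auto

lemma exponential_universal:
  assumes "Z \<in> Obj C" "A \<in> Obj C" "I \<in> Obj C" "f \<in> Hom C (Prod C Z A) I"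
  shows "\<exists>!g. g \<in> Hom C Z (Exp C A I) \<and> Eval C A I \<cdot> Prod_map C g (Ident C A) = f"
  using exponential_cone_is_exponential[OF assms(2,3)] assms(1,4) unfolding is_exponential_def by blast

lemma Curry_props:
  assumes "Z \<in> Obj C" "A \<in> Obj C" "I \<in> Obj C" "f \<in> Hom C (Prod C Z A) I"
  shows Curry_in_Hom: "Curry C Z A I f \<in> Hom C Z (Exp C A I)"
    and Eval_Curry: "Eval C A I \<cdot> Prod_map C (Curry C Z A I f) (Ident C A) = f"
  using theI'[OF exponential_universal[OF assms]] unfolding Curry_def by auto

text \<open>
  The defining equation of the transpose, evaluated at a generalized element \<open>(u, a)\<close> of \<open>Z \<times> A\<close>.
  All later computations with internal homs are done on such elements.
\<close>

lemma Eval_Curry_Pairing: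
  assumes f: "f \<in> Hom C (Prod C Z A) I" and u: "u \<in> Hom C Y Z" and a: "a \<in> Hom C Y A"
  shows "Eval C A I \<cdot> Pairing C (Curry C Z A I f \<cdot> u) a = f \<cdot> Pairing C u a"
proof -
  have O: "Z \<in> Obj C" "A \<in> Obj C" "I \<in> Obj C" using f u a Hom_Obj by auto
  note c = Curry_props[OF O f]
  note i = Ident_in_Hom[OF O(2)]
  show ?thesis
    using Comp_assoc[OF Pairing_in_Hom[OF u a] Prod_map_in_Hom[OF c(1) i] Eval_in_Hom[OF O(2,3)]]
      Prod_map_Pairing[OF c(1) i u a] Comp_Ident_left[OF a] c(2) by simp
qed

text \<open>
  On generalized elements \<open>[m, I]\<close> sends \<open>u\<close> to the function \<open>a \<mapsto> u (m a)\<close>.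
\<close>

lemma Exp_precomp_props:
  assumes I: "I \<in> Obj C" and m: "m \<in> Hom C A B"
  shows Exp_precomp_in_Hom: "Exp_precomp C m I \<in> Hom C (Exp C B I) (Exp C A I)"
    and Eval_Exp_precomp: "u \<in> Hom C Y (Exp C B I) \<Longrightarrow> a \<in> Hom C Y A \<Longrightarrow>
      Eval C A I \<cdot> Pairing C (Exp_precomp C m I \<cdot> u) a = Eval C B I \<cdot> Pairing C u (m \<cdot> a)"
proof -
  have O: "A \<in> Obj C" "B \<in> Obj C" using m Hom_Obj by auto
  have d: "Dom C m = A" "Cod C m = B" using m by (auto simp: Hom_def)
  note E = Exp_Obj[OF O(2) I] and ev = Eval_in_Hom[OF O(2) I]
  note h = Prod_map_in_Hom[OF Ident_in_Hom[OF E] m]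
  note f = Comp_in_Hom[OF h ev]
  show "Exp_precomp C m I \<in> Hom C (Exp C B I) (Exp C A I)"
    unfolding Exp_precomp_def d by (rule Curry_in_Hom[OF E O(1) I f])
  assume u: "u \<in> Hom C Y (Exp C B I)" and a: "a \<in> Hom C Y A"
  show "Eval C A I \<cdot> Pairing C (Exp_precomp C m I \<cdot> u) a = Eval C B I \<cdot> Pairing C u (m \<cdot> a)"
    unfolding Exp_precomp_def d
    using Eval_Curry_Pairing[OF f u a] Comp_assoc[OF Pairing_in_Hom[OF u a] h ev]
      Prod_map_Pairing[OF Ident_in_Hom[OF E] m u a] Comp_Ident_left[OF u] by simp
qed

text \<open>
  The transpose of an extension of evaluation to \<open>[A, I] \<times> B\<close> is a section of \<open>[B, I] \<rightarrow> [A, I]\<close>: it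
  assigns to each function on \<open>A\<close> an extension to \<open>B\<close>, uniformly in the function.
\<close>

lemma externally_injective_imp_internally_injective:
  assumes "externally_injective C I"
  shows "internally_injective C I"
  unfolding internally_injective_def
proof (intro conjI allI impI)
  show I: "I \<in> Obj C" using assms unfolding externally_injective_def by blast
  fix m assume mono: "monomorphism C m"
  define A B where "A = Dom C m" and "B = Cod C m"
  have m: "m \<in> Hom C A B" using mono unfolding monomorphism_def A_def B_def by (simp add: Hom_def)
  have O: "A \<in> Obj C" "B \<in> Obj C" using m Hom_Obj by auto
  define E where "E = Exp C A I"
  have E: "E \<in> Obj C" unfolding E_def by (rule Exp_Obj[OF O(1) I])
  have ev: "Eval C A I \<in> Hom C (Prod C E A) I" unfolding E_def by (rule Eval_in_Hom[OF O(1) I])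
  define h where "h = Prod_map C (Ident C E) m"
  have h: "h \<in> Hom C (Prod C E A) (Prod C E B)"
    unfolding h_def by (rule Prod_map_in_Hom[OF Ident_in_Hom[OF E] m])
  have hd: "Dom C h = Prod C E A" "Cod C h = Prod C E B" using h by (auto simp: Hom_def)
  have "monomorphism C h" unfolding h_def by (rule Prod_map_mono[OF E m mono])
  then have "(\<lambda>g. g \<cdot> h) ` Hom C (Prod C E B) I = Hom C (Prod C E A) I"
    using assms hd unfolding externally_injective_def by force
  \<comment> \<open>Evaluation is itself an instance of the external extension problem.\<close>
  then obtain q where q: "q \<in> Hom C (Prod C E B) I" and qh: "q \<cdot> h = Eval C A I"
    using ev by (metis (no_types, lifting) imageE)
  define s where "s = Curry C E B I q"
  have s: "s \<in> Hom C E (Exp C B I)" unfolding s_def by (rule Curry_in_Hom[OF E O(2) I q])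
  define e where "e = Exp_precomp C m I"
  have e: "e \<in> Hom C (Exp C B I) E" unfolding e_def E_def by (rule Exp_precomp_in_Hom[OF I m])
  have es: "e \<cdot> s \<in> Hom C E E" by (rule Comp_in_Hom[OF s e])
  note p = Fst_in_Hom[OF E O(1)] and r = Snd_in_Hom[OF E O(1)]
  note i = Ident_in_Hom[OF E] and iA = Ident_in_Hom[OF O(1)]
  have d: "Dom C (e \<cdot> s) = E" "Dom C (Ident C A) = A" using es iA by (auto simp: Hom_def)
  \<comment> \<open>The transposes of \<open>e \<cdot> s\<close> and of the identity agree, both being the evaluation map.\<close>
  have "Eval C A I \<cdot> Prod_map C (e \<cdot> s) (Ident C A)
      = Eval C A I \<cdot> Pairing C (e \<cdot> (s \<cdot> Fst C E A)) (Snd C E A)"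
    unfolding Prod_map_def d using Comp_Ident_left[OF r] Comp_assoc[OF p s e] by simp
  also have "\<dots> = Eval C B I \<cdot> Pairing C (s \<cdot> Fst C E A) (m \<cdot> Snd C E A)"
    unfolding e_def by (rule Eval_Exp_precomp[OF I m Comp_in_Hom[OF p s] r])
  also have "\<dots> = q \<cdot> Pairing C (Fst C E A) (m \<cdot> Snd C E A)"
    unfolding s_def by (rule Eval_Curry_Pairing[OF q p Comp_in_Hom[OF r m]])
  also have "\<dots> = q \<cdot> h"
    unfolding h_def Prod_map_def using Comp_Ident_left[OF p] i m by (simp add: Hom_def)
  also have "\<dots> = Eval C A I \<cdot> Prod_map C (Ident C E) (Ident C A)"
    using qh Prod_map_Ident[OF E O(1)] Comp_Ident_right[OF ev] by simp
  finally have "e \<cdot> s = Ident C E"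
    using exponential_universal[OF E O(1) I ev] es i Prod_map_Ident[OF E O(1)]
      Comp_Ident_right[OF ev] unfolding E_def by metis
  then show "epimorphism C (Exp_precomp C m I)"
    using split_epimorphism[OF e s] unfolding e_def by blast
qed

end

section \<open>Internal injectivity in terms of generalized elements\<close>

text \<open>
  For the epimorphism \<open>e : [B, I] \<rightarrow> [A, I]\<close> induced by \<open>n\<close> and the name \<open>k : T \<rightarrow> [A, I]\<close> of \<open>f\<close>, a stage
  \<open>Z\<close> with \<open>e \<psi> = k y\<close> is one at which some \<open>\<psi> : Z \<rightarrow> [B, I]\<close> restricts to \<open>f\<close> on \<open>A\<close>. Evaluating \<open>\<psi>\<close> at
  an element \<open>b : Z \<rightarrow> B\<close> then gives an element \<open>r\<close> of \<open>I\<close>, which is \<open>f a\<close> wherever \<open>b\<close> is the image of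
  an element \<open>a\<close> of \<open>A\<close>. Existentially quantifying \<open>P\<close>, \<open>Q\<close>, \<open>e\<close> and \<open>k\<close> leaves a condition on hom sets only,
  which does not depend on products or internal homs and can be moved along an equivalence.
\<close>

definition extends_over_epis :: "('o, 'a) category \<Rightarrow> 'o \<Rightarrow> bool" where
  "extends_over_epis C I \<longleftrightarrow>
    (\<forall>A B T n f. monomorphism C n \<longrightarrow> n \<in> Hom C A B \<longrightarrow> f \<in> Hom C A I \<longrightarrow> T \<in> Obj C \<longrightarrow>
      (\<exists>P Q e k. epimorphism C e \<and> e \<in> Hom C P Q \<and> k \<in> Hom C T Q \<and>
        (\<forall>Z \<psi> y b. \<psi> \<in> Hom C Z P \<longrightarrow> y \<in> Hom C Z T \<longrightarrow> b \<in> Hom C Z B \<longrightarrow>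
          e \<cdot>\<^bsub>C\<^esub> \<psi> = k \<cdot>\<^bsub>C\<^esub> y \<longrightarrow>
          (\<exists>r \<in> Hom C Z I. \<forall>Z' z a. z \<in> Hom C Z' Z \<longrightarrow> a \<in> Hom C Z' A \<longrightarrow>
            b \<cdot>\<^bsub>C\<^esub> z = n \<cdot>\<^bsub>C\<^esub> a \<longrightarrow> r \<cdot>\<^bsub>C\<^esub> z = f \<cdot>\<^bsub>C\<^esub> a))))"

lemma (in elementary_topos) internally_injective_extends_over_epis:
  assumes "internally_injective C I"
  shows "extends_over_epis C I"
  unfolding extends_over_epis_def
proof (intro allI impI)
  have I: "I \<in> Obj C" using assms unfolding internally_injective_def by blast
  fix A B T n f
  assume mono: "monomorphism C n" and n: "n \<in> Hom C A B" and f: "f \<in> Hom C A I" and T: "T \<in> Obj C"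
  have O: "A \<in> Obj C" "B \<in> Obj C" using n Hom_Obj by auto
  define e where "e = Exp_precomp C n I"
  have epi: "epimorphism C e" using assms mono unfolding internally_injective_def e_def by blast
  have e: "e \<in> Hom C (Exp C B I) (Exp C A I)"
    unfolding e_def by (rule Exp_precomp_in_Hom[OF I n])
  note q = Snd_in_Hom[OF T O(1)]
  note fq = Comp_in_Hom[OF q f]
  define k where "k = Curry C T A I (f \<cdot> Snd C T A)"
  have k: "k \<in> Hom C T (Exp C A I)" unfolding k_def by (rule Curry_in_Hom[OF T O(1) I fq])
  show "\<exists>P Q e k. epimorphism C e \<and> e \<in> Hom C P Q \<and> k \<in> Hom C T Q \<and>
        (\<forall>Z \<psi> y b. \<psi> \<in> Hom C Z P \<longrightarrow> y \<in> Hom C Z T \<longrightarrow> b \<in> Hom C Z B \<longrightarrow> e \<cdot> \<psi> = k \<cdot> y \<longrightarrow>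
          (\<exists>r \<in> Hom C Z I. \<forall>Z' z a. z \<in> Hom C Z' Z \<longrightarrow> a \<in> Hom C Z' A \<longrightarrow>
            b \<cdot> z = n \<cdot> a \<longrightarrow> r \<cdot> z = f \<cdot> a))"
  proof (intro exI conjI allI impI)
    show "epimorphism C e" "e \<in> Hom C (Exp C B I) (Exp C A I)" "k \<in> Hom C T (Exp C A I)"
      by fact+
    fix Z \<psi> y b
    assume \<psi>: "\<psi> \<in> Hom C Z (Exp C B I)" and y: "y \<in> Hom C Z T" and b: "b \<in> Hom C Z B"
      and eq: "e \<cdot> \<psi> = k \<cdot> y"
    note ev = Eval_in_Hom[OF O(2) I] and \<psi>b = Pairing_in_Hom[OF \<psi> b]
    show "\<exists>r \<in> Hom C Z I. \<forall>Z' z a. z \<in> Hom C Z' Z \<longrightarrow> a \<in> Hom C Z' A \<longrightarrow>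
            b \<cdot> z = n \<cdot> a \<longrightarrow> r \<cdot> z = f \<cdot> a"
    proof (intro bexI allI impI)
      show "Eval C B I \<cdot> Pairing C \<psi> b \<in> Hom C Z I" by (rule Comp_in_Hom[OF \<psi>b ev])
      fix Z' z a assume z: "z \<in> Hom C Z' Z" and a: "a \<in> Hom C Z' A" and bz: "b \<cdot> z = n \<cdot> a"
      note yz = Comp_in_Hom[OF z y]
      have "(Eval C B I \<cdot> Pairing C \<psi> b) \<cdot> z = Eval C B I \<cdot> Pairing C (\<psi> \<cdot> z) (n \<cdot> a)"
        using Comp_assoc[OF z \<psi>b ev] Pairing_Comp[OF \<psi> b z] bz by simp
      also have "\<dots> = Eval C A I \<cdot> Pairing C (e \<cdot> (\<psi> \<cdot> z)) a"
        unfolding e_def using Eval_Exp_precomp[OF I n Comp_in_Hom[OF z \<psi>] a] by simp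
      also have "e \<cdot> (\<psi> \<cdot> z) = k \<cdot> (y \<cdot> z)"
        using Comp_assoc[OF z \<psi> e] Comp_assoc[OF z y k] eq by simp
      also have "Eval C A I \<cdot> Pairing C (k \<cdot> (y \<cdot> z)) a = (f \<cdot> Snd C T A) \<cdot> Pairing C (y \<cdot> z) a"
        unfolding k_def by (rule Eval_Curry_Pairing[OF fq yz a])
      also have "\<dots> = f \<cdot> a"
        using Comp_assoc[OF Pairing_in_Hom[OF yz a] q f] Snd_Pairing[OF yz a] by simp
      finally show "(Eval C B I \<cdot> Pairing C \<psi> b) \<cdot> z = f \<cdot> a" .
    qed
  qed
qed

section \<open>Transport along an equivalence\<close>

text \<open>
  Fully faithful and essentially surjective functors are the form of equivalence in which
  extension problems are easiest to move: every object of \<open>D\<close> is replaced by an isomorphic one in the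
  image of the functor, and morphisms between those come from \<open>C\<close>.
\<close>

locale ff_eso_functor = C: category C + D: category D
  for C :: "('o, 'a) category" and D :: "('p, 'b) category" +
  fixes F0 :: "'o \<Rightarrow> 'p" and F1 :: "'a \<Rightarrow> 'b"
  assumes functor_F: "is_functor C D F0 F1"
    and faithful: "f \<in> Hom C A B \<Longrightarrow> g \<in> Hom C A B \<Longrightarrow> F1 f = F1 g \<Longrightarrow> f = g"
    and full: "A \<in> Obj C \<Longrightarrow> B \<in> Obj C \<Longrightarrow> h \<in> Hom D (F0 A) (F0 B) \<Longrightarrow> \<exists>f \<in> Hom C A B. F1 f = h"
    and eso: "Y \<in> Obj D \<Longrightarrow> \<exists>A \<in> Obj C. \<exists>\<alpha> \<in> Hom D (F0 A) Y. isomorphism D \<alpha>"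
begin

lemma F_in_Hom: "f \<in> Hom C A B \<Longrightarrow> F1 f \<in> Hom D (F0 A) (F0 B)"
  and F_Comp: "f \<in> Hom C A B \<Longrightarrow> g \<in> Hom C B E \<Longrightarrow> F1 (g \<cdot>\<^bsub>C\<^esub> f) = F1 g \<cdot>\<^bsub>D\<^esub> F1 f"
  using functor_F unfolding is_functor_def by (auto simp: Hom_def)

lemma replacement:
  assumes "Y \<in> Obj D"
  obtains A \<alpha> \<alpha>' where "A \<in> Obj C" "\<alpha> \<in> Hom D (F0 A) Y" "\<alpha>' \<in> Hom D Y (F0 A)"
    "\<alpha>' \<cdot>\<^bsub>D\<^esub> \<alpha> = Ident D (F0 A)" "\<alpha> \<cdot>\<^bsub>D\<^esub> \<alpha>' = Ident D Y"
proof -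
  obtain A \<alpha> where A: "A \<in> Obj C" and \<alpha>: "\<alpha> \<in> Hom D (F0 A) Y" and iso: "isomorphism D \<alpha>"
    using eso[OF assms] by blast
  then have "\<exists>\<alpha>' \<in> Hom D Y (F0 A). \<alpha>' \<cdot>\<^bsub>D\<^esub> \<alpha> = Ident D (F0 A) \<and> \<alpha> \<cdot>\<^bsub>D\<^esub> \<alpha>' = Ident D Y"
    unfolding isomorphism_def by (auto simp: Hom_def)
  then show thesis using that[OF A \<alpha>] by blast
qed

lemma preserves_mono:
  assumes m: "m \<in> Hom C A B" and mono: "monomorphism C m"
  shows "monomorphism D (F1 m)"
proof (rule D.monomorphismI[OF F_in_Hom[OF m]])
  have A: "A \<in> Obj C" using m C.Hom_Obj by auto
  fix Z u v
  assume u: "u \<in> Hom D Z (F0 A)" and v: "v \<in> Hom D Z (F0 A)"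
    and eq: "F1 m \<cdot>\<^bsub>D\<^esub> u = F1 m \<cdot>\<^bsub>D\<^esub> v"
  have "Z \<in> Obj D" using u D.Hom_Obj by auto
  then obtain Y \<alpha> \<alpha>' where Y: "Y \<in> Obj C" and \<alpha>: "\<alpha> \<in> Hom D (F0 Y) Z" "\<alpha>' \<in> Hom D Z (F0 Y)"
    and inv: "\<alpha> \<cdot>\<^bsub>D\<^esub> \<alpha>' = Ident D Z"
    by (rule replacement)
  obtain u' where u': "u' \<in> Hom C Y A" "F1 u' = u \<cdot>\<^bsub>D\<^esub> \<alpha>"
    using full[OF Y A D.Comp_in_Hom[OF \<alpha>(1) u]] by blast
  obtain v' where v': "v' \<in> Hom C Y A" "F1 v' = v \<cdot>\<^bsub>D\<^esub> \<alpha>"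
    using full[OF Y A D.Comp_in_Hom[OF \<alpha>(1) v]] by blast
  have "F1 (m \<cdot>\<^bsub>C\<^esub> u') = F1 (m \<cdot>\<^bsub>C\<^esub> v')"
    using F_Comp[OF u'(1) m] F_Comp[OF v'(1) m] u'(2) v'(2) eq
      D.Comp_assoc[OF \<alpha>(1) u F_in_Hom[OF m]] D.Comp_assoc[OF \<alpha>(1) v F_in_Hom[OF m]] by simp
  then have "m \<cdot>\<^bsub>C\<^esub> u' = m \<cdot>\<^bsub>C\<^esub> v'"
    by (rule faithful[OF C.Comp_in_Hom[OF u'(1) m] C.Comp_in_Hom[OF v'(1) m]])
  then have "u' = v'" by (rule C.monomorphismD[OF mono m u'(1) v'(1)])
  then have "(u \<cdot>\<^bsub>D\<^esub> \<alpha>) \<cdot>\<^bsub>D\<^esub> \<alpha>' = (v \<cdot>\<^bsub>D\<^esub> \<alpha>) \<cdot>\<^bsub>D\<^esub> \<alpha>'" using u'(2) v'(2) by simp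
  then show "u = v"
    using D.Comp_assoc[OF \<alpha>(2,1) u] D.Comp_assoc[OF \<alpha>(2,1) v] inv
      D.Comp_Ident_right[OF u] D.Comp_Ident_right[OF v] by simp
qed

lemma preserves_epi:
  assumes e: "e \<in> Hom C P Q" and epi: "epimorphism C e"
  shows "epimorphism D (F1 e)"
proof (rule D.epimorphismI[OF F_in_Hom[OF e]])
  have Q: "Q \<in> Obj C" using e C.Hom_Obj by auto
  fix Z u v
  assume u: "u \<in> Hom D (F0 Q) Z" and v: "v \<in> Hom D (F0 Q) Z"
    and eq: "u \<cdot>\<^bsub>D\<^esub> F1 e = v \<cdot>\<^bsub>D\<^esub> F1 e"
  have "Z \<in> Obj D" using u D.Hom_Obj by auto
  then obtain Y \<alpha> \<alpha>' where Y: "Y \<in> Obj C" and \<alpha>: "\<alpha> \<in> Hom D (F0 Y) Z" "\<alpha>' \<in> Hom D Z (F0 Y)"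
    and inv: "\<alpha> \<cdot>\<^bsub>D\<^esub> \<alpha>' = Ident D Z"
    by (rule replacement)
  obtain u' where u': "u' \<in> Hom C Q Y" "F1 u' = \<alpha>' \<cdot>\<^bsub>D\<^esub> u"
    using full[OF Q Y D.Comp_in_Hom[OF u \<alpha>(2)]] by blast
  obtain v' where v': "v' \<in> Hom C Q Y" "F1 v' = \<alpha>' \<cdot>\<^bsub>D\<^esub> v"
    using full[OF Q Y D.Comp_in_Hom[OF v \<alpha>(2)]] by blast
  have "F1 (u' \<cdot>\<^bsub>C\<^esub> e) = F1 (v' \<cdot>\<^bsub>C\<^esub> e)"
    using F_Comp[OF e u'(1)] F_Comp[OF e v'(1)] u'(2) v'(2) eq
      D.Comp_assoc[OF F_in_Hom[OF e] u \<alpha>(2)] D.Comp_assoc[OF F_in_Hom[OF e] v \<alpha>(2)] by simp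
  then have "u' \<cdot>\<^bsub>C\<^esub> e = v' \<cdot>\<^bsub>C\<^esub> e"
    by (rule faithful[OF C.Comp_in_Hom[OF e u'(1)] C.Comp_in_Hom[OF e v'(1)]])
  then have "u' = v'" by (rule C.epimorphismD[OF epi e u'(1) v'(1)])
  then have "\<alpha> \<cdot>\<^bsub>D\<^esub> (\<alpha>' \<cdot>\<^bsub>D\<^esub> u) = \<alpha> \<cdot>\<^bsub>D\<^esub> (\<alpha>' \<cdot>\<^bsub>D\<^esub> v)" using u'(2) v'(2) by simp
  then show "u = v"
    using D.Comp_assoc[OF u \<alpha>(2,1)] D.Comp_assoc[OF v \<alpha>(2,1)] inv
      D.Comp_Ident_left[OF u] D.Comp_Ident_left[OF v] by simp
qed

lemma reflects_mono:
  assumes m: "m \<in> Hom C A B" and mono: "monomorphism D (F1 m)"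
  shows "monomorphism C m"
proof (rule C.monomorphismI[OF m])
  fix Z u v assume u: "u \<in> Hom C Z A" and v: "v \<in> Hom C Z A" and eq: "m \<cdot>\<^bsub>C\<^esub> u = m \<cdot>\<^bsub>C\<^esub> v"
  then have "F1 m \<cdot>\<^bsub>D\<^esub> F1 u = F1 m \<cdot>\<^bsub>D\<^esub> F1 v" using F_Comp[OF u m] F_Comp[OF v m] by simp
  then have "F1 u = F1 v"
    by (rule D.monomorphismD[OF mono F_in_Hom[OF m] F_in_Hom[OF u] F_in_Hom[OF v]])
  then show "u = v" by (rule faithful[OF u v])
qed

text \<open>
  Given an extension problem in \<open>D\<close>, replace \<open>A\<close>, \<open>B\<close> and \<open>T\<close> by isomorphic objects in the image of the
  functor and solve the resulting problem in \<open>C\<close>. The stages \<open>Z\<close> and \<open>Z'\<close> over which the solution is tested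
  range over all objects of \<open>D\<close>, so they are replaced in the same way.
\<close>

lemma transport_extends_over_epis:
  assumes ext: "extends_over_epis C I" and I: "I \<in> Obj C"
  shows "extends_over_epis D (F0 I)"
  unfolding extends_over_epis_def
proof (intro allI impI)
  have cancel: "v \<cdot>\<^bsub>D\<^esub> (u \<cdot>\<^bsub>D\<^esub> w) = w"
    if "v \<cdot>\<^bsub>D\<^esub> u = Ident D A" "u \<in> Hom D A B" "v \<in> Hom D B A" "w \<in> Arr D" "Cod D w = A" for u v w A B
    using that D.Comp_assoc[of w "Dom D w" A u B v A] D.Comp_Ident_left[of w "Dom D w" A]
    by (simp add: Hom_def)
  fix A B T n f
  assume mono: "monomorphism D n" and n: "n \<in> Hom D A B" and f: "f \<in> Hom D A (F0 I)"
    and T: "T \<in> Obj D"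
  have "A \<in> Obj D" "B \<in> Obj D" using n D.Hom_Obj by auto
  obtain A' \<alpha> \<alpha>' where A': "A' \<in> Obj C" and \<alpha>: "\<alpha> \<in> Hom D (F0 A') A" "\<alpha>' \<in> Hom D A (F0 A')"
    and inv\<alpha>: "\<alpha>' \<cdot>\<^bsub>D\<^esub> \<alpha> = Ident D (F0 A')" "\<alpha> \<cdot>\<^bsub>D\<^esub> \<alpha>' = Ident D A"
    using \<open>A \<in> Obj D\<close> by (rule replacement)
  obtain B' \<beta> \<beta>' where B': "B' \<in> Obj C" and \<beta>: "\<beta> \<in> Hom D (F0 B') B" "\<beta>' \<in> Hom D B (F0 B')"
    and inv\<beta>: "\<beta>' \<cdot>\<^bsub>D\<^esub> \<beta> = Ident D (F0 B')" "\<beta> \<cdot>\<^bsub>D\<^esub> \<beta>' = Ident D B"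
    using \<open>B \<in> Obj D\<close> by (rule replacement)
  obtain T' \<tau> \<tau>' where T': "T' \<in> Obj C" and \<tau>: "\<tau> \<in> Hom D (F0 T') T" "\<tau>' \<in> Hom D T (F0 T')"
    and inv\<tau>: "\<tau>' \<cdot>\<^bsub>D\<^esub> \<tau> = Ident D (F0 T')" "\<tau> \<cdot>\<^bsub>D\<^esub> \<tau>' = Ident D T"
    using T by (rule replacement)
  have "\<beta>' \<cdot>\<^bsub>D\<^esub> n \<cdot>\<^bsub>D\<^esub> \<alpha> \<in> Hom D (F0 A') (F0 B')"
    using n \<alpha> \<beta> D.Comp_in_Hom by blast
  then obtain n' where n': "n' \<in> Hom C A' B'" and Fn': "F1 n' = \<beta>' \<cdot>\<^bsub>D\<^esub> n \<cdot>\<^bsub>D\<^esub> \<alpha>"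
    using full[OF A' B'] by blast
  obtain f' where f': "f' \<in> Hom C A' I" and Ff': "F1 f' = f \<cdot>\<^bsub>D\<^esub> \<alpha>"
    using full[OF A' I D.Comp_in_Hom[OF \<alpha>(1) f]] by blast
  have "monomorphism D (F1 n')"
  proof (rule D.monomorphismI[OF F_in_Hom[OF n']])
    fix Z u v assume u: "u \<in> Hom D Z (F0 A')" and v: "v \<in> Hom D Z (F0 A')"
      and eq: "F1 n' \<cdot>\<^bsub>D\<^esub> u = F1 n' \<cdot>\<^bsub>D\<^esub> v"
    have "n \<cdot>\<^bsub>D\<^esub> (\<alpha> \<cdot>\<^bsub>D\<^esub> w) = \<beta> \<cdot>\<^bsub>D\<^esub> (F1 n' \<cdot>\<^bsub>D\<^esub> w)" if "w \<in> Hom D Z (F0 A')" for w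
      using that n \<alpha> \<beta> cancel[OF inv\<beta>(2) \<beta>(2,1), of "n \<cdot>\<^bsub>D\<^esub> (\<alpha> \<cdot>\<^bsub>D\<^esub> w)"] unfolding Fn'
      by (simp add: D.arrow_simps)
    then have "n \<cdot>\<^bsub>D\<^esub> (\<alpha> \<cdot>\<^bsub>D\<^esub> u) = n \<cdot>\<^bsub>D\<^esub> (\<alpha> \<cdot>\<^bsub>D\<^esub> v)" using u v eq by simp
    then have "\<alpha> \<cdot>\<^bsub>D\<^esub> u = \<alpha> \<cdot>\<^bsub>D\<^esub> v"
      by (rule D.monomorphismD[OF mono n D.Comp_in_Hom[OF u \<alpha>(1)] D.Comp_in_Hom[OF v \<alpha>(1)]])
    moreover have "\<alpha>' \<cdot>\<^bsub>D\<^esub> (\<alpha> \<cdot>\<^bsub>D\<^esub> w) = w" if "w \<in> Hom D Z (F0 A')" for w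
      using cancel[OF inv\<alpha>(1) \<alpha>, of w] that by (simp add: Hom_def)
    ultimately show "u = v" using u v by metis
  qed
  then have mono': "monomorphism C n'" by (rule reflects_mono[OF n'])
  obtain P Q e k where epi: "epimorphism C e" and e: "e \<in> Hom C P Q" and k: "k \<in> Hom C T' Q"
    and sol: "\<And>Z \<psi> y b. \<psi> \<in> Hom C Z P \<Longrightarrow> y \<in> Hom C Z T' \<Longrightarrow> b \<in> Hom C Z B' \<Longrightarrow>
      e \<cdot>\<^bsub>C\<^esub> \<psi> = k \<cdot>\<^bsub>C\<^esub> y \<Longrightarrow>
      \<exists>r \<in> Hom C Z I. \<forall>Z' z a. z \<in> Hom C Z' Z \<longrightarrow> a \<in> Hom C Z' A' \<longrightarrow>
        b \<cdot>\<^bsub>C\<^esub> z = n' \<cdot>\<^bsub>C\<^esub> a \<longrightarrow> r \<cdot>\<^bsub>C\<^esub> z = f' \<cdot>\<^bsub>C\<^esub> a"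
    using ext[unfolded extends_over_epis_def, rule_format, OF mono' n' f' T'] by blast
  have P: "P \<in> Obj C" using e C.Hom_Obj by auto
  show "\<exists>P Q e k. epimorphism D e \<and> e \<in> Hom D P Q \<and> k \<in> Hom D T Q \<and>
        (\<forall>Z \<psi> y b. \<psi> \<in> Hom D Z P \<longrightarrow> y \<in> Hom D Z T \<longrightarrow> b \<in> Hom D Z B \<longrightarrow>
          e \<cdot>\<^bsub>D\<^esub> \<psi> = k \<cdot>\<^bsub>D\<^esub> y \<longrightarrow>
          (\<exists>r \<in> Hom D Z (F0 I). \<forall>Z' z a. z \<in> Hom D Z' Z \<longrightarrow> a \<in> Hom D Z' A \<longrightarrow>
            b \<cdot>\<^bsub>D\<^esub> z = n \<cdot>\<^bsub>D\<^esub> a \<longrightarrow> r \<cdot>\<^bsub>D\<^esub> z = f \<cdot>\<^bsub>D\<^esub> a))"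
  proof (intro exI conjI allI impI)
    show "epimorphism D (F1 e)" by (rule preserves_epi[OF e epi])
    show Fe: "F1 e \<in> Hom D (F0 P) (F0 Q)" by (rule F_in_Hom[OF e])
    show "F1 k \<cdot>\<^bsub>D\<^esub> \<tau>' \<in> Hom D T (F0 Q)" by (rule D.Comp_in_Hom[OF \<tau>(2) F_in_Hom[OF k]])
    fix Z \<psi> y b
    assume \<psi>: "\<psi> \<in> Hom D Z (F0 P)" and y: "y \<in> Hom D Z T" and b: "b \<in> Hom D Z B"
      and eq: "F1 e \<cdot>\<^bsub>D\<^esub> \<psi> = (F1 k \<cdot>\<^bsub>D\<^esub> \<tau>') \<cdot>\<^bsub>D\<^esub> y"
    have "Z \<in> Obj D" using \<psi> D.Hom_Obj by auto
    then obtain Y \<zeta> \<zeta>' where Y: "Y \<in> Obj C" and \<zeta>: "\<zeta> \<in> Hom D (F0 Y) Z" "\<zeta>' \<in> Hom D Z (F0 Y)"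
      and inv\<zeta>: "\<zeta>' \<cdot>\<^bsub>D\<^esub> \<zeta> = Ident D (F0 Y)" "\<zeta> \<cdot>\<^bsub>D\<^esub> \<zeta>' = Ident D Z"
      by (rule replacement)
    obtain \<psi>' where \<psi>': "\<psi>' \<in> Hom C Y P" and F\<psi>': "F1 \<psi>' = \<psi> \<cdot>\<^bsub>D\<^esub> \<zeta>"
      using full[OF Y P D.Comp_in_Hom[OF \<zeta>(1) \<psi>]] by blast
    have "\<tau>' \<cdot>\<^bsub>D\<^esub> y \<cdot>\<^bsub>D\<^esub> \<zeta> \<in> Hom D (F0 Y) (F0 T')" using y \<zeta> \<tau> D.Comp_in_Hom by blast
    then obtain y' where y': "y' \<in> Hom C Y T'" and Fy': "F1 y' = \<tau>' \<cdot>\<^bsub>D\<^esub> y \<cdot>\<^bsub>D\<^esub> \<zeta>"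
      using full[OF Y T'] by blast
    have "\<beta>' \<cdot>\<^bsub>D\<^esub> b \<cdot>\<^bsub>D\<^esub> \<zeta> \<in> Hom D (F0 Y) (F0 B')" using b \<zeta> \<beta> D.Comp_in_Hom by blast
    then obtain b' where b': "b' \<in> Hom C Y B'" and Fb': "F1 b' = \<beta>' \<cdot>\<^bsub>D\<^esub> b \<cdot>\<^bsub>D\<^esub> \<zeta>"
      using full[OF Y B'] by blast
    have "F1 e \<cdot>\<^bsub>D\<^esub> (\<psi> \<cdot>\<^bsub>D\<^esub> \<zeta>) = (F1 e \<cdot>\<^bsub>D\<^esub> \<psi>) \<cdot>\<^bsub>D\<^esub> \<zeta>"
      using D.Comp_assoc[OF \<zeta>(1) \<psi> Fe] by simp
    also have "\<dots> = F1 k \<cdot>\<^bsub>D\<^esub> (\<tau>' \<cdot>\<^bsub>D\<^esub> y \<cdot>\<^bsub>D\<^esub> \<zeta>)"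
      using eq F_in_Hom[OF k] \<tau> y \<zeta> by (simp add: D.arrow_simps)
    finally have "F1 (e \<cdot>\<^bsub>C\<^esub> \<psi>') = F1 (k \<cdot>\<^bsub>C\<^esub> y')"
      unfolding F_Comp[OF \<psi>' e] F_Comp[OF y' k] F\<psi>' Fy' .
    then have "e \<cdot>\<^bsub>C\<^esub> \<psi>' = k \<cdot>\<^bsub>C\<^esub> y'"
      by (rule faithful[OF C.Comp_in_Hom[OF \<psi>' e] C.Comp_in_Hom[OF y' k]])
    from sol[OF \<psi>' y' b' this] obtain r where r: "r \<in> Hom C Y I"
      and r_ext: "\<And>Z' z a. z \<in> Hom C Z' Y \<Longrightarrow> a \<in> Hom C Z' A' \<Longrightarrow>
        b' \<cdot>\<^bsub>C\<^esub> z = n' \<cdot>\<^bsub>C\<^esub> a \<Longrightarrow> r \<cdot>\<^bsub>C\<^esub> z = f' \<cdot>\<^bsub>C\<^esub> a" by blast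
    note Fr = F_in_Hom[OF r]
    show "\<exists>r \<in> Hom D Z (F0 I). \<forall>Z' z a. z \<in> Hom D Z' Z \<longrightarrow> a \<in> Hom D Z' A \<longrightarrow>
            b \<cdot>\<^bsub>D\<^esub> z = n \<cdot>\<^bsub>D\<^esub> a \<longrightarrow> r \<cdot>\<^bsub>D\<^esub> z = f \<cdot>\<^bsub>D\<^esub> a"
    proof (intro bexI allI impI)
      show "F1 r \<cdot>\<^bsub>D\<^esub> \<zeta>' \<in> Hom D Z (F0 I)" by (rule D.Comp_in_Hom[OF \<zeta>(2) Fr])
      fix Z' z a assume z: "z \<in> Hom D Z' Z" and a: "a \<in> Hom D Z' A"
        and bz: "b \<cdot>\<^bsub>D\<^esub> z = n \<cdot>\<^bsub>D\<^esub> a"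
      have "Z' \<in> Obj D" using z D.Hom_Obj by auto
      then obtain W \<omega> \<omega>' where W: "W \<in> Obj C" and \<omega>: "\<omega> \<in> Hom D (F0 W) Z'" "\<omega>' \<in> Hom D Z' (F0 W)"
        and inv\<omega>: "\<omega>' \<cdot>\<^bsub>D\<^esub> \<omega> = Ident D (F0 W)" "\<omega> \<cdot>\<^bsub>D\<^esub> \<omega>' = Ident D Z'"
        by (rule replacement)
      have "\<zeta>' \<cdot>\<^bsub>D\<^esub> z \<cdot>\<^bsub>D\<^esub> \<omega> \<in> Hom D (F0 W) (F0 Y)" using z \<zeta> \<omega> D.Comp_in_Hom by blast
      then obtain z' where z': "z' \<in> Hom C W Y" and Fz': "F1 z' = \<zeta>' \<cdot>\<^bsub>D\<^esub> z \<cdot>\<^bsub>D\<^esub> \<omega>"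
        using full[OF W Y] by blast
      have "\<alpha>' \<cdot>\<^bsub>D\<^esub> a \<cdot>\<^bsub>D\<^esub> \<omega> \<in> Hom D (F0 W) (F0 A')" using a \<alpha> \<omega> D.Comp_in_Hom by blast
      then obtain a' where a': "a' \<in> Hom C W A'" and Fa': "F1 a' = \<alpha>' \<cdot>\<^bsub>D\<^esub> a \<cdot>\<^bsub>D\<^esub> \<omega>"
        using full[OF W A'] by blast
      note c\<zeta> = cancel[OF inv\<zeta>(2) \<zeta>(2,1)] and c\<alpha> = cancel[OF inv\<alpha>(2) \<alpha>(2,1)]
      have c1: "\<zeta> \<cdot>\<^bsub>D\<^esub> (\<zeta>' \<cdot>\<^bsub>D\<^esub> (z \<cdot>\<^bsub>D\<^esub> \<omega>)) = z \<cdot>\<^bsub>D\<^esub> \<omega>"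
        by (rule c\<zeta>) (use z \<omega> in \<open>auto simp: D.arrow_simps\<close>)
      have c2: "\<alpha> \<cdot>\<^bsub>D\<^esub> (\<alpha>' \<cdot>\<^bsub>D\<^esub> (a \<cdot>\<^bsub>D\<^esub> \<omega>)) = a \<cdot>\<^bsub>D\<^esub> \<omega>"
        by (rule c\<alpha>) (use a \<omega> in \<open>auto simp: D.arrow_simps\<close>)
      have "F1 b' \<cdot>\<^bsub>D\<^esub> F1 z' = \<beta>' \<cdot>\<^bsub>D\<^esub> (b \<cdot>\<^bsub>D\<^esub> z) \<cdot>\<^bsub>D\<^esub> \<omega>"
        unfolding Fb' Fz' using b z \<beta> \<zeta> \<omega> c1 by (simp add: D.arrow_simps)
      also have "\<dots> = F1 n' \<cdot>\<^bsub>D\<^esub> F1 a'"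
        unfolding bz Fn' Fa' using n a \<beta> \<alpha> \<omega> c2 by (simp add: D.arrow_simps)
      finally have "F1 (b' \<cdot>\<^bsub>C\<^esub> z') = F1 (n' \<cdot>\<^bsub>C\<^esub> a')"
        using F_Comp[OF z' b'] F_Comp[OF a' n'] by simp
      then have "b' \<cdot>\<^bsub>C\<^esub> z' = n' \<cdot>\<^bsub>C\<^esub> a'"
        by (rule faithful[OF C.Comp_in_Hom[OF z' b'] C.Comp_in_Hom[OF a' n']])
      then have "r \<cdot>\<^bsub>C\<^esub> z' = f' \<cdot>\<^bsub>C\<^esub> a'" by (rule r_ext[OF z' a'])
      then have rz: "F1 r \<cdot>\<^bsub>D\<^esub> F1 z' = F1 f' \<cdot>\<^bsub>D\<^esub> F1 a'"
        using F_Comp[OF z' r] F_Comp[OF a' f'] by simp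
      have "((F1 r \<cdot>\<^bsub>D\<^esub> \<zeta>') \<cdot>\<^bsub>D\<^esub> z) \<cdot>\<^bsub>D\<^esub> \<omega> = F1 r \<cdot>\<^bsub>D\<^esub> F1 z'"
        unfolding Fz' using Fr z \<zeta> \<omega> by (simp add: D.arrow_simps)
      also have "\<dots> = (f \<cdot>\<^bsub>D\<^esub> a) \<cdot>\<^bsub>D\<^esub> \<omega>"
        unfolding rz Ff' Fa' using f a \<alpha> \<omega> c2 by (simp add: D.arrow_simps)
      finally have "(((F1 r \<cdot>\<^bsub>D\<^esub> \<zeta>') \<cdot>\<^bsub>D\<^esub> z) \<cdot>\<^bsub>D\<^esub> \<omega>) \<cdot>\<^bsub>D\<^esub> \<omega>' = ((f \<cdot>\<^bsub>D\<^esub> a) \<cdot>\<^bsub>D\<^esub> \<omega>) \<cdot>\<^bsub>D\<^esub> \<omega>'"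
        by simp
      moreover have "(w \<cdot>\<^bsub>D\<^esub> \<omega>) \<cdot>\<^bsub>D\<^esub> \<omega>' = w" if "w \<in> Hom D Z' (F0 I)" for w
        using D.Comp_assoc[OF \<omega>(2,1) that] inv\<omega>(2) D.Comp_Ident_right[OF that] by simp
      moreover have "(F1 r \<cdot>\<^bsub>D\<^esub> \<zeta>') \<cdot>\<^bsub>D\<^esub> z \<in> Hom D Z' (F0 I)"
        by (rule D.Comp_in_Hom[OF z D.Comp_in_Hom[OF \<zeta>(2) Fr]])
      moreover have "f \<cdot>\<^bsub>D\<^esub> a \<in> Hom D Z' (F0 I)" by (rule D.Comp_in_Hom[OF a f])
      ultimately show "(F1 r \<cdot>\<^bsub>D\<^esub> \<zeta>') \<cdot>\<^bsub>D\<^esub> z = f \<cdot>\<^bsub>D\<^esub> a" by simp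
    qed
  qed
qed

end

text \<open>
  Naturality gives \<open>f \<tau>\<^sub>A = \<tau>\<^sub>B GFf\<close>, and the isomorphism \<open>\<tau>\<^sub>A\<close> can be cancelled.
\<close>

lemma faithful_of_retraction:
  assumes "category C" and G: "is_functor D C G0 G1" and F: "is_functor C D F0 F1"
    and nat: "naturally_isomorphic C C (G0 \<circ> F0) (G1 \<circ> F1) id id"
    and f: "f \<in> Hom C A B" and g: "g \<in> Hom C A B" and eq: "F1 f = F1 g"
  shows "f = g"
proof -
  interpret category C by fact
  obtain \<tau> where \<tau>: "\<And>A. A \<in> Obj C \<Longrightarrow> \<tau> A \<in> Hom C (G0 (F0 A)) A \<and> isomorphism C (\<tau> A)"
    and nat: "\<And>f. f \<in> Arr C \<Longrightarrow> \<tau> (Cod C f) \<cdot>\<^bsub>C\<^esub> G1 (F1 f) = f \<cdot>\<^bsub>C\<^esub> \<tau> (Dom C f)"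
    using nat unfolding naturally_isomorphic_def by auto
  have A: "A \<in> Obj C" using f Hom_Obj by auto
  then obtain \<tau>' where \<tau>': "\<tau>' \<in> Hom C A (G0 (F0 A))" "\<tau> A \<cdot>\<^bsub>C\<^esub> \<tau>' = Ident C A"
    using \<tau>[OF A] unfolding isomorphism_def by (auto simp: Hom_def)
  have "f \<cdot>\<^bsub>C\<^esub> \<tau> A = g \<cdot>\<^bsub>C\<^esub> \<tau> A" using nat[of f] nat[of g] f g eq by (simp add: Hom_def)
  then have "(f \<cdot>\<^bsub>C\<^esub> \<tau> A) \<cdot>\<^bsub>C\<^esub> \<tau>' = (g \<cdot>\<^bsub>C\<^esub> \<tau> A) \<cdot>\<^bsub>C\<^esub> \<tau>'" by simp
  then show ?thesis
    using Comp_assoc[OF \<tau>'(1) conjunct1[OF \<tau>[OF A]] f] Comp_assoc[OF \<tau>'(1) conjunct1[OF \<tau>[OF A]] g]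
      \<tau>'(2) Comp_Ident_right[OF f] Comp_Ident_right[OF g] by simp
qed

lemma equivalent_categories_ff_eso:
  assumes "category C" and "category D" and "equivalent_categories C D"
  obtains F0 F1 where "ff_eso_functor C D F0 F1"
proof -
  interpret C: category C by fact
  interpret D: category D by fact
  obtain F0 F1 G0 G1 where F: "is_functor C D F0 F1" and G: "is_functor D C G0 G1"
    and GF: "naturally_isomorphic C C (G0 \<circ> F0) (G1 \<circ> F1) id id"
    and FG: "naturally_isomorphic D D (F0 \<circ> G0) (F1 \<circ> G1) id id"
    using assms(3) unfolding equivalent_categories_def by blast
  have "ff_eso_functor C D F0 F1"
  proof
    show "is_functor C D F0 F1" by fact
    show "f = g" if "f \<in> Hom C A B" "g \<in> Hom C A B" "F1 f = F1 g" for f g A B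
      by (rule faithful_of_retraction[OF assms(1) G F GF that])
    show "\<exists>A \<in> Obj C. \<exists>\<alpha> \<in> Hom D (F0 A) Y. isomorphism D \<alpha>" if "Y \<in> Obj D" for Y
      using FG G that unfolding naturally_isomorphic_def is_functor_def by fastforce
    show "\<exists>f \<in> Hom C A B. F1 f = h"
      if A: "A \<in> Obj C" and B: "B \<in> Obj C" and h: "h \<in> Hom D (F0 A) (F0 B)" for A B h
    proof -
      obtain \<tau> where \<tau>: "\<And>A. A \<in> Obj C \<Longrightarrow> \<tau> A \<in> Hom C (G0 (F0 A)) A"
          "\<And>A. A \<in> Obj C \<Longrightarrow> isomorphism C (\<tau> A)"
        and nat: "\<And>f. f \<in> Arr C \<Longrightarrow> \<tau> (Cod C f) \<cdot>\<^bsub>C\<^esub> G1 (F1 f) = f \<cdot>\<^bsub>C\<^esub> \<tau> (Dom C f)"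
        using GF unfolding naturally_isomorphic_def by auto
      obtain \<alpha> where \<alpha>: "\<alpha> \<in> Hom C A (G0 (F0 A))" "\<alpha> \<cdot>\<^bsub>C\<^esub> \<tau> A = Ident C (G0 (F0 A))"
        using \<tau>[OF A] unfolding isomorphism_def by (auto simp: Hom_def)
      obtain \<beta> where \<beta>: "\<beta> \<in> Hom C B (G0 (F0 B))" "\<beta> \<cdot>\<^bsub>C\<^esub> \<tau> B = Ident C (G0 (F0 B))"
        using \<tau>[OF B] unfolding isomorphism_def by (auto simp: Hom_def)
      have Gh: "G1 h \<in> Hom C (G0 (F0 A)) (G0 (F0 B))"
        using G h unfolding is_functor_def by (auto simp: Hom_def)
      \<comment> \<open>This \<open>f\<close> is chosen with \<open>G F f = G h\<close>, so that \<open>F f = h\<close> follows because \<open>G\<close> is faithful.\<close>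
      define f where "f = \<tau> B \<cdot>\<^bsub>C\<^esub> (G1 h \<cdot>\<^bsub>C\<^esub> \<alpha>)"
      note Gh\<alpha> = C.Comp_in_Hom[OF \<alpha>(1) Gh]
      have f: "f \<in> Hom C A B" unfolding f_def by (rule C.Comp_in_Hom[OF Gh\<alpha> \<tau>(1)[OF B]])
      have Ff: "F1 f \<in> Hom D (F0 A) (F0 B)" using F f unfolding is_functor_def by (auto simp: Hom_def)
      have GFf: "G1 (F1 f) \<in> Hom C (G0 (F0 A)) (G0 (F0 B))"
        using G Ff unfolding is_functor_def by (auto simp: Hom_def)
      have "\<tau> B \<cdot>\<^bsub>C\<^esub> G1 (F1 f) = f \<cdot>\<^bsub>C\<^esub> \<tau> A" using nat[of f] f by (simp add: Hom_def)
      also have "\<dots> = \<tau> B \<cdot>\<^bsub>C\<^esub> (G1 h \<cdot>\<^bsub>C\<^esub> (\<alpha> \<cdot>\<^bsub>C\<^esub> \<tau> A))"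
        unfolding f_def using \<tau>(1)[OF A] \<tau>(1)[OF B] \<alpha>(1) Gh by (simp add: C.arrow_simps)
      also have "\<dots> = \<tau> B \<cdot>\<^bsub>C\<^esub> G1 h" using \<alpha>(2) C.Comp_Ident_right[OF Gh] by simp
      finally have "\<beta> \<cdot>\<^bsub>C\<^esub> (\<tau> B \<cdot>\<^bsub>C\<^esub> G1 (F1 f)) = \<beta> \<cdot>\<^bsub>C\<^esub> (\<tau> B \<cdot>\<^bsub>C\<^esub> G1 h)" by simp
      then have "G1 (F1 f) = G1 h"
        using C.Comp_assoc[OF Gh \<tau>(1)[OF B] \<beta>(1)] C.Comp_assoc[OF GFf \<tau>(1)[OF B] \<beta>(1)] \<beta>(2)
          C.Comp_Ident_left[OF Gh] C.Comp_Ident_left[OF GFf] by simp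
      then have "F1 f = h" by (rule faithful_of_retraction[OF assms(2) F G FG Ff h])
      then show ?thesis using f by blast
    qed
  qed
  then show thesis by (rule that)
qed

section \<open>Covers\<close>

context frame
begin

text \<open>
  The opens below \<open>U\<close> that satisfy \<open>P\<close> cover \<open>U\<close>. Stating local properties through this predicate, instead of
  indexed families, makes refinement of covers a manipulation of predicates.
\<close>

definition covers :: "'u \<Rightarrow> ('u \<Rightarrow> bool) \<Rightarrow> bool" where
  "covers U P \<longleftrightarrow> U \<in> carrier X \<and> \<Squnion> {V \<in> carrier X. V \<sqsubseteq> U \<and> P V} = U"

lemma coversI:
  assumes "S \<subseteq> carrier X" "\<And>V. V \<in> S \<Longrightarrow> P V"
  shows "covers (\<Squnion> S) P"
  unfolding covers_def
proof (intro conjI le_antisym)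
  show c: "\<Squnion> S \<in> carrier X" "\<Squnion> S \<in> carrier X" using assms(1) by simp_all
  let ?T = "{V \<in> carrier X. V \<sqsubseteq> \<Squnion> S \<and> P V}"
  have T: "?T \<subseteq> carrier X" by blast
  then show "\<Squnion> ?T \<in> carrier X" by simp
  show "\<Squnion> ?T \<sqsubseteq> \<Squnion> S" by (rule sup_least[OF T c(1)]) blast
  have "S \<subseteq> ?T" using assms sup_upper[OF assms(1)] by blast
  then show "\<Squnion> S \<sqsubseteq> \<Squnion> ?T"
    by (intro sup_least[OF assms(1)]) (use T sup_upper[OF T] in auto)
qed

lemma covers_carrier: "covers U P \<Longrightarrow> U \<in> carrier X"
  unfolding covers_def by blast

lemma covers_le:
  assumes "covers U P" "W \<in> carrier X" "\<And>V. V \<in> carrier X \<Longrightarrow> V \<sqsubseteq> U \<Longrightarrow> P V \<Longrightarrow> V \<sqsubseteq> W"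
  shows "U \<sqsubseteq> W"
proof -
  have "\<Squnion> {V \<in> carrier X. V \<sqsubseteq> U \<and> P V} \<sqsubseteq> W" by (rule sup_least) (use assms in auto)
  then show ?thesis using assms(1) unfolding covers_def by simp
qed

lemma covers_leI:
  assumes U: "U \<in> carrier X"
    and le: "\<And>W. W \<in> carrier X \<Longrightarrow> (\<And>V. V \<in> carrier X \<Longrightarrow> V \<sqsubseteq> U \<Longrightarrow> P V \<Longrightarrow> V \<sqsubseteq> W) \<Longrightarrow> U \<sqsubseteq> W"
  shows "covers U P"
  unfolding covers_def
proof (intro conjI le_antisym U)
  let ?T = "{V \<in> carrier X. V \<sqsubseteq> U \<and> P V}"
  have T: "?T \<subseteq> carrier X" by blast
  then show c: "\<Squnion> ?T \<in> carrier X" by simp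
  show "\<Squnion> ?T \<sqsubseteq> U" by (rule sup_least[OF T U]) blast
  show "U \<sqsubseteq> \<Squnion> ?T" by (rule le[OF c]) (use sup_upper[OF T] in blast)
qed

lemma covers_self: "U \<in> carrier X \<Longrightarrow> P U \<Longrightarrow> covers U P"
  by (rule covers_leI) auto

lemma covers_trans:
  assumes P: "covers U P" and Q: "\<And>V. V \<in> carrier X \<Longrightarrow> V \<sqsubseteq> U \<Longrightarrow> P V \<Longrightarrow> covers V Q"
  shows "covers U Q"
proof (rule covers_leI[OF covers_carrier[OF P]])
  note U = covers_carrier[OF P]
  fix W assume W: "W \<in> carrier X" and le: "\<And>V. V \<in> carrier X \<Longrightarrow> V \<sqsubseteq> U \<Longrightarrow> Q V \<Longrightarrow> V \<sqsubseteq> W"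
  show "U \<sqsubseteq> W"
  proof (rule covers_le[OF P W])
    fix V assume V: "V \<in> carrier X" "V \<sqsubseteq> U" "P V"
    show "V \<sqsubseteq> W"
      by (rule covers_le[OF Q[OF V] W]) (use le V(1,2) U le_trans in blast)
  qed
qed

lemma covers_mono:
  assumes "covers U P" "\<And>V. V \<in> carrier X \<Longrightarrow> V \<sqsubseteq> U \<Longrightarrow> P V \<Longrightarrow> Q V"
  shows "covers U Q"
  using assms covers_self covers_trans by metis

lemma meet_absorb:
  assumes "V \<in> carrier X" "U \<in> carrier X" "V \<sqsubseteq> U"
  shows "U \<sqinter> V = V" "V \<sqinter> U = V"
proof -
  show "U \<sqinter> V = V"
    by (rule le_antisym[OF _ meet_le]) (use assms in \<open>simp_all add: meet_right\<close>)
  then show "V \<sqinter> U = V" by (simp add: meet_comm[of X V U])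
qed

text \<open>
  This is where the infinite distributive law of frames enters: the meets of \<open>W\<close> with the members of a cover of \<open>U\<close>
  cover \<open>W\<close>.
\<close>

lemma covers_restrict:
  assumes P: "covers U P" and W: "W \<in> carrier X" "W \<sqsubseteq> U"
    and Q: "\<And>V. V \<in> carrier X \<Longrightarrow> V \<sqsubseteq> U \<Longrightarrow> P V \<Longrightarrow> Q (W \<sqinter> V)"
  shows "covers W Q"
proof -
  let ?S = "{V \<in> carrier X. V \<sqsubseteq> U \<and> P V}"
  have U: "U \<in> carrier X" and S: "\<Squnion> ?S = U" using P unfolding covers_def by auto
  have "W = W \<sqinter> \<Squnion> ?S" using meet_absorb(2)[OF W(1) U W(2)] unfolding S by simp
  also have "\<dots> = \<Squnion> ((\<lambda>V. W \<sqinter> V) ` ?S)" by (rule meet_Sup_distrib[OF W(1)]) blast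
  finally have "W = \<Squnion> ((\<lambda>V. W \<sqinter> V) ` ?S)" .
  moreover have "covers (\<Squnion> ((\<lambda>V. W \<sqinter> V) ` ?S)) Q"
    by (rule coversI) (use W Q in auto)
  ultimately show ?thesis by simp
qed

text \<open>
  Over each member of the first cover the second one restricts to a cover, by the meets of both; this
  is why the two predicates have to be inherited by smaller opens.
\<close>

lemma covers_conj:
  assumes P: "covers U P" and Q: "covers U Q"
    and down: "\<And>V W. V \<in> carrier X \<Longrightarrow> V \<sqsubseteq> U \<Longrightarrow> W \<in> carrier X \<Longrightarrow> W \<sqsubseteq> V \<Longrightarrow> P V \<Longrightarrow> P W"
      "\<And>V W. V \<in> carrier X \<Longrightarrow> V \<sqsubseteq> U \<Longrightarrow> W \<in> carrier X \<Longrightarrow> W \<sqsubseteq> V \<Longrightarrow> Q V \<Longrightarrow> Q W"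
  shows "covers U (\<lambda>V. P V \<and> Q V)"
proof (rule covers_trans[OF P])
  fix V assume V: "V \<in> carrier X" "V \<sqsubseteq> U" "P V"
  show "covers V (\<lambda>V. P V \<and> Q V)"
  proof (rule covers_restrict[OF Q V(1,2)])
    fix W assume W: "W \<in> carrier X" "W \<sqsubseteq> U" "Q W"
    have c: "V \<sqinter> W \<in> carrier X" "V \<sqinter> W \<sqsubseteq> V" "V \<sqinter> W \<sqsubseteq> W"
      using V(1) W(1) by (auto simp: meet_left meet_right)
    show "P (V \<sqinter> W) \<and> Q (V \<sqinter> W)"
      using down(1)[OF V(1,2) c(1,2) V(3)] down(2)[OF W(1,2) c(1,3) W(3)] by blast
  qed
qed

end

section \<open>Sheaves\<close>

locale sheaf_topos = frame X + set_universe \<U> for X :: "'u gorder" (structure) and \<U> :: "'u set set" +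
  assumes small: "carrier X \<in> \<U>"
begin

abbreviation "Sheaf \<equiv> is_sheaf \<U> X"
abbreviation "res \<equiv> restriction"

lemma restriction_closed:
  "Sheaf F \<Longrightarrow> U \<in> carrier X \<Longrightarrow> V \<in> carrier X \<Longrightarrow> V \<sqsubseteq> U \<Longrightarrow> s \<in> sections F U \<Longrightarrow> res F U V s \<in> sections F V"
  unfolding is_sheaf_def is_presheaf_def by blast

lemma restriction_id: "Sheaf F \<Longrightarrow> U \<in> carrier X \<Longrightarrow> s \<in> sections F U \<Longrightarrow> res F U U s = s"
  unfolding is_sheaf_def is_presheaf_def by blast

lemma restriction_restriction:
  "Sheaf F \<Longrightarrow> U \<in> carrier X \<Longrightarrow> V \<in> carrier X \<Longrightarrow> W \<in> carrier X \<Longrightarrow> W \<sqsubseteq> V \<Longrightarrow> V \<sqsubseteq> U \<Longrightarrow>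
    s \<in> sections F U \<Longrightarrow> res F V W (res F U V s) = res F U W s"
  unfolding is_sheaf_def is_presheaf_def by blast

lemma sheaf_amalgamation:
  assumes "Sheaf F" "S \<subseteq> carrier X" "\<And>V. V \<in> S \<Longrightarrow> \<sigma> V \<in> sections F V"
    and "\<And>V W. V \<in> S \<Longrightarrow> W \<in> S \<Longrightarrow> res F V (V \<sqinter> W) (\<sigma> V) = res F W (V \<sqinter> W) (\<sigma> W)"
  shows "\<exists>!t. t \<in> sections F (\<Squnion> S) \<and> (\<forall>V \<in> S. res F (\<Squnion> S) V t = \<sigma> V)"
  by (rule assms(1)[unfolded is_sheaf_def, THEN conjunct2, rule_format]) (use assms(2-4) in auto)

text \<open>
  Both sections glue the family of restrictions of \<open>t\<close>.
\<close>

lemma sheaf_separated: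
  assumes F: "Sheaf F" and t: "t \<in> sections F U" "t' \<in> sections F U"
    and cov: "covers U (\<lambda>V. res F U V t = res F U V t')"
  shows "t = t'"
proof -
  let ?S = "{V \<in> carrier X. V \<sqsubseteq> U \<and> res F U V t = res F U V t'}"
  have U: "U \<in> carrier X" and S: "\<Squnion> ?S = U" using cov unfolding covers_def by auto
  have "\<exists>!u. u \<in> sections F (\<Squnion> ?S) \<and> (\<forall>V \<in> ?S. res F (\<Squnion> ?S) V u = res F U V t)"
  proof (rule sheaf_amalgamation[OF F])
    fix V W assume V: "V \<in> ?S" and W: "W \<in> ?S"
    then show "res F V (V \<sqinter> W) (res F U V t) = res F W (V \<sqinter> W) (res F U W t)"
      using U t restriction_restriction[OF F U, of V "V \<sqinter> W"] restriction_restriction[OF F U, of W "V \<sqinter> W"]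
        meet_left meet_right by auto
  qed (use F U t restriction_closed in auto)
  then show ?thesis unfolding S using t by auto
qed

lemma sheaf_glue:
  assumes F: "Sheaf F" and cov: "covers U P"
    and \<sigma>: "\<And>V. V \<in> carrier X \<Longrightarrow> V \<sqsubseteq> U \<Longrightarrow> P V \<Longrightarrow> \<sigma> V \<in> sections F V"
    and compat: "\<And>V W. V \<in> carrier X \<Longrightarrow> V \<sqsubseteq> U \<Longrightarrow> P V \<Longrightarrow> W \<in> carrier X \<Longrightarrow> W \<sqsubseteq> U \<Longrightarrow> P W \<Longrightarrow>
      res F V (V \<sqinter> W) (\<sigma> V) = res F W (V \<sqinter> W) (\<sigma> W)"
  shows "\<exists>t \<in> sections F U. \<forall>V \<in> carrier X. V \<sqsubseteq> U \<longrightarrow> P V \<longrightarrow> res F U V t = \<sigma> V"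
proof -
  let ?S = "{V \<in> carrier X. V \<sqsubseteq> U \<and> P V}"
  have S: "\<Squnion> ?S = U" using cov unfolding covers_def by auto
  have "\<exists>!t. t \<in> sections F (\<Squnion> ?S) \<and> (\<forall>V \<in> ?S. res F (\<Squnion> ?S) V t = \<sigma> V)"
    by (rule sheaf_amalgamation[OF F]) (use \<sigma> compat in auto)
  then show ?thesis unfolding S by blast
qed

definition subsheaf :: "'u presheaf_data \<Rightarrow> ('u \<Rightarrow> 'u set) \<Rightarrow> 'u presheaf_data" where
  "subsheaf B D = \<lparr>sections = D, restriction = restriction B\<rparr>"

lemma subsheaf_simps [simp]: "sections (subsheaf B D) = D" "restriction (subsheaf B D) = restriction B"
  unfolding subsheaf_def by simp_all

text \<open>
  Compatible families in \<open>D\<close> glue uniquely in \<open>B\<close>; it is locality of \<open>D\<close> that brings the result back into \<open>D\<close>.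
\<close>

lemma subsheaf_is_sheaf:
  assumes B: "Sheaf B" and sub: "\<And>U. U \<in> carrier X \<Longrightarrow> D U \<subseteq> sections B U"
    and restr: "\<And>U V s. U \<in> carrier X \<Longrightarrow> V \<in> carrier X \<Longrightarrow> V \<sqsubseteq> U \<Longrightarrow> s \<in> D U \<Longrightarrow> res B U V s \<in> D V"
    and loc: "\<And>U s. s \<in> sections B U \<Longrightarrow> covers U (\<lambda>V. res B U V s \<in> D V) \<Longrightarrow> s \<in> D U"
  shows "Sheaf (subsheaf B D)"
  unfolding is_sheaf_def
proof (intro conjI allI impI)
  show "is_presheaf \<U> X (subsheaf B D)"
    unfolding is_presheaf_def subsheaf_simps
  proof (intro conjI ballI impI funcsetI)
    fix U assume U: "U \<in> carrier X"
    have "sections B U \<in> \<U>" using B U unfolding is_sheaf_def is_presheaf_def by blast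
    then show "D U \<in> \<U>" using sub[OF U] by (rule subset_closed)
    fix s assume "s \<in> D U"
    then have s: "s \<in> sections B U" using sub[OF U] by blast
    show "res B U U s = s" by (rule restriction_id[OF B U s])
    show "res B V W (res B U V s) = res B U W s"
      if "V \<in> carrier X" "W \<in> carrier X" "W \<sqsubseteq> V" "V \<sqsubseteq> U" for V W
      by (rule restriction_restriction[OF B U that s])
  qed (rule restr)
  fix S \<sigma>
  assume S: "S \<subseteq> carrier X" and \<sigma>: "\<forall>V \<in> S. \<sigma> V \<in> sections (subsheaf B D) V"
    and compat: "\<forall>V \<in> S. \<forall>W \<in> S. res (subsheaf B D) V (V \<sqinter> W) (\<sigma> V) = res (subsheaf B D) W (V \<sqinter> W) (\<sigma> W)"
  have "\<exists>!t. t \<in> sections B (\<Squnion> S) \<and> (\<forall>V \<in> S. res B (\<Squnion> S) V t = \<sigma> V)"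
    proof (rule sheaf_amalgamation[OF B S])
    show "\<sigma> V \<in> sections B V" if "V \<in> S" for V using \<sigma> sub[of V] S that by auto
  qed (use compat in auto)
  moreover have "t \<in> D (\<Squnion> S)" if "t \<in> sections B (\<Squnion> S)" "\<forall>V \<in> S. res B (\<Squnion> S) V t = \<sigma> V" for t
    by (rule loc[OF that(1)], rule coversI[OF S]) (use that \<sigma> in auto)
  moreover have "D (\<Squnion> S) \<subseteq> sections B (\<Squnion> S)" using sub S by simp
  ultimately show "\<exists>!t. t \<in> sections (subsheaf B D) (\<Squnion> S) \<and> (\<forall>V \<in> S. res (subsheaf B D) (\<Squnion> S) V t = \<sigma> V)"
    by (simp add: Ex1_def) blast
qed

text \<open>
  For an open \<open>U\<close> this is the product of \<open>B\<close> with the subterminal sheaf that corresponds to \<open>U\<close>, realized as a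
  subsheaf of \<open>B\<close>. For the terminal sheaf it gives that subterminal, which is the sheaf represented by \<open>U\<close>.
\<close>

definition restrict_to :: "'u presheaf_data \<Rightarrow> 'u \<Rightarrow> 'u presheaf_data" where
  "restrict_to B U = subsheaf B (\<lambda>W. if W \<sqsubseteq> U then sections B W else {})"

lemma restrict_to_simps [simp]:
  "sections (restrict_to B U) W = (if W \<sqsubseteq> U then sections B W else {})"
  "restriction (restrict_to B U) = restriction B"
  unfolding restrict_to_def by simp_all

lemma restrict_to_is_sheaf:
  assumes B: "Sheaf B" and U: "U \<in> carrier X"
  shows "Sheaf (restrict_to B U)"
  unfolding restrict_to_def
proof (rule subsheaf_is_sheaf[OF B])
  fix W V s
  assume "W \<in> carrier X" "V \<in> carrier X" "V \<sqsubseteq> W" "s \<in> (if W \<sqsubseteq> U then sections B W else {})"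
  then show "res B W V s \<in> (if V \<sqsubseteq> U then sections B V else {})"
    using restriction_closed[OF B, of W V s] le_trans[of V W U] U by (auto split: if_splits)
next
  fix W s
  assume s: "s \<in> sections B W" and cov: "covers W (\<lambda>V. res B W V s \<in> (if V \<sqsubseteq> U then sections B V else {}))"
  have "W \<sqsubseteq> U" by (rule covers_le[OF cov U]) (auto split: if_splits)
  then show "s \<in> (if W \<sqsubseteq> U then sections B W else {})" using s by simp
qed auto

text \<open>
  Any element would do as the only section; the bottom element is at hand and makes the singleton small.
\<close>

definition terminal_sheaf :: "'u presheaf_data" where
  "terminal_sheaf = \<lparr>sections = (\<lambda>U. {\<bottom>}), restriction = (\<lambda>U V s. \<bottom>)\<rparr>"

lemma terminal_sheaf_simps [simp]:
  "sections terminal_sheaf U = {\<bottom>}" "restriction terminal_sheaf U V s = \<bottom>"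
  unfolding terminal_sheaf_def by simp_all

lemma terminal_sheaf_is_sheaf: "Sheaf terminal_sheaf"
proof -
  have "{\<bottom>} \<in> \<U>" by (rule subset_closed[OF small]) simp
  then show ?thesis unfolding is_sheaf_def is_presheaf_def by auto
qed

text \<open>
  The subobject classifier of \<open>Sh(X)\<close>: the truth values over \<open>U\<close> are the opens below \<open>U\<close>.
\<close>

definition Omega :: "'u presheaf_data" where
  "Omega = \<lparr>sections = (\<lambda>U. {V \<in> carrier X. V \<sqsubseteq> U}), restriction = (\<lambda>U V W. V \<sqinter> W)\<rparr>"

lemma Omega_simps [simp]:
  "sections Omega U = {V \<in> carrier X. V \<sqsubseteq> U}" "restriction Omega U V W = V \<sqinter> W"
  unfolding Omega_def by simp_all

text \<open>
  Compatible truth values \<open>\<sigma> V\<close> are glued by their join. Its restriction to \<open>V\<close> is \<open>\<sigma> V\<close> because the part of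
  any other \<open>\<sigma> W\<close> that lies below \<open>V\<close> already lies below \<open>\<sigma> V\<close>, by compatibility on \<open>V \<sqinter> W\<close>.
\<close>

lemma Omega_is_sheaf: "Sheaf Omega"
  unfolding is_sheaf_def
proof (intro conjI allI impI)
  show "is_presheaf \<U> X Omega"
    unfolding is_presheaf_def
  proof (intro conjI ballI impI)
    show "sections Omega U \<in> \<U>" for U by (rule subset_closed[OF small]) auto
    fix U V W s assume U: "U \<in> carrier X" and V: "V \<in> carrier X" and W: "W \<in> carrier X"
      and le: "W \<sqsubseteq> V" "V \<sqsubseteq> U" and s: "s \<in> sections Omega U"
    have "W \<sqinter> (V \<sqinter> s) = (V \<sqinter> W) \<sqinter> s"
      using V W s meet_assoc[of W V s] meet_comm[of X V W] by simp
    then show "res Omega V W (res Omega U V s) = res Omega U W s"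
      using V W le meet_absorb[of W V] by simp
  qed (auto simp: meet_absorb meet_left)
  fix S \<sigma>
  assume S: "S \<subseteq> carrier X" and \<sigma>: "\<forall>V \<in> S. \<sigma> V \<in> sections Omega V"
    and compat: "\<forall>V \<in> S. \<forall>W \<in> S. res Omega V (V \<sqinter> W) (\<sigma> V) = res Omega W (V \<sqinter> W) (\<sigma> W)"
  have \<sigma>S: "\<sigma> ` S \<subseteq> carrier X" using \<sigma> by auto
  have c: "\<Squnion> S \<in> carrier X" "\<Squnion> (\<sigma> ` S) \<in> carrier X" using S \<sigma>S by simp_all
  show "\<exists>!t. t \<in> sections Omega (\<Squnion> S) \<and> (\<forall>V \<in> S. res Omega (\<Squnion> S) V t = \<sigma> V)"
  proof (rule ex1I)
    have "V \<sqinter> \<Squnion> (\<sigma> ` S) = \<sigma> V" if V: "V \<in> S" for V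
    proof (rule le_antisym)
      have Vc: "V \<in> carrier X" and \<sigma>V: "\<sigma> V \<in> carrier X" "\<sigma> V \<sqsubseteq> V" using V S \<sigma> by auto
      show "V \<sqinter> \<Squnion> (\<sigma> ` S) \<in> carrier X" "\<sigma> V \<in> carrier X" using Vc c \<sigma>V by auto
      show "\<sigma> V \<sqsubseteq> V \<sqinter> \<Squnion> (\<sigma> ` S)"
        by (rule meet_le[OF \<sigma>V(2) sup_upper[OF \<sigma>S] Vc c(2) \<sigma>V(1)]) (use V in blast)
      have "V \<sqinter> \<Squnion> (\<sigma> ` S) = \<Squnion> ((\<lambda>W. V \<sqinter> W) ` \<sigma> ` S)" by (rule meet_Sup_distrib[OF Vc \<sigma>S])
      also have "\<dots> \<sqsubseteq> \<sigma> V"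
      proof (rule sup_least)
        show "(\<lambda>W. V \<sqinter> W) ` \<sigma> ` S \<subseteq> carrier X" using Vc \<sigma>S by auto
        fix U assume "U \<in> (\<lambda>W. V \<sqinter> W) ` \<sigma> ` S"
        then obtain W where W: "W \<in> S" and U: "U = V \<sqinter> \<sigma> W" by auto
        have Wc: "W \<in> carrier X" and \<sigma>W: "\<sigma> W \<in> carrier X" "\<sigma> W \<sqsubseteq> W" using W S \<sigma> by auto
        have "U = (V \<sqinter> W) \<sqinter> \<sigma> W" unfolding U using meet_assoc[OF Vc Wc \<sigma>W(1)] meet_absorb(1)[OF \<sigma>W(1) Wc \<sigma>W(2)] by simp
        also have "\<dots> = (V \<sqinter> W) \<sqinter> \<sigma> V" using bspec[OF bspec[OF compat V] W] by simp
        also have "\<dots> \<sqsubseteq> \<sigma> V" using Vc Wc \<sigma>V by (simp add: meet_right)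
        finally show "U \<sqsubseteq> \<sigma> V" .
      qed (rule \<sigma>V(1))
      finally show "V \<sqinter> \<Squnion> (\<sigma> ` S) \<sqsubseteq> \<sigma> V" .
    qed
    moreover have "\<Squnion> (\<sigma> ` S) \<sqsubseteq> \<Squnion> S"
    proof (rule sup_least[OF \<sigma>S c(1)])
      fix U assume "U \<in> \<sigma> ` S"
      then obtain V where V: "V \<in> S" and U: "U = \<sigma> V" by auto
      show "U \<sqsubseteq> \<Squnion> S"
        using le_trans[of "\<sigma> V" V "\<Squnion> S"] V S \<sigma> c(1) sup_upper[OF S V] unfolding U by auto
    qed
    ultimately show "\<Squnion> (\<sigma> ` S) \<in> sections Omega (\<Squnion> S) \<and>
        (\<forall>V \<in> S. res Omega (\<Squnion> S) V (\<Squnion> (\<sigma> ` S)) = \<sigma> V)" using c by simp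
    fix t assume t: "t \<in> sections Omega (\<Squnion> S) \<and> (\<forall>V \<in> S. res Omega (\<Squnion> S) V t = \<sigma> V)"
    then have tc: "t \<in> carrier X" "t \<sqsubseteq> \<Squnion> S" by auto
    have "t = t \<sqinter> \<Squnion> S" using meet_absorb(2)[OF tc(1) c(1) tc(2)] by simp
    also have "\<dots> = \<Squnion> ((\<lambda>V. t \<sqinter> V) ` S)" by (rule meet_Sup_distrib[OF tc(1) S])
    also have "(\<lambda>V. t \<sqinter> V) ` S = \<sigma> ` S" using t meet_comm[of X t] by (intro image_cong) auto
    finally show "t = \<Squnion> (\<sigma> ` S)" .
  qed
qed

section \<open>Sheaf morphisms\<close>

abbreviation "ShX \<equiv> Sh \<U> X"

definition sheaf_map :: "'u presheaf_data \<Rightarrow> 'u presheaf_data \<Rightarrow> ('u \<Rightarrow> 'u \<Rightarrow> 'u) \<Rightarrow> 'u sheaf_morphism" where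
  "sheaf_map F G \<phi> = \<lparr>source = F, target = G,
    component = (\<lambda>U \<in> carrier X. \<lambda>s \<in> sections F U. \<phi> U s)\<rparr>"

lemma component_sheaf_map [simp]:
  "U \<in> carrier X \<Longrightarrow> s \<in> sections F U \<Longrightarrow> component (sheaf_map F G \<phi>) U s = \<phi> U s"
  unfolding sheaf_map_def by simp

lemma Sh_Obj: "F \<in> Obj ShX \<longleftrightarrow> Sheaf F"
  unfolding Sh_def by simp

lemma Sh_Hom_iff: "\<eta> \<in> Hom ShX F G \<longleftrightarrow> is_sheaf_morphism \<U> X \<eta> \<and> source \<eta> = F \<and> target \<eta> = G"
  unfolding Sh_def Hom_def by simp

lemma sheaf_map_in_Hom:
  assumes "Sheaf F" "Sheaf G"
    and "\<And>U s. U \<in> carrier X \<Longrightarrow> s \<in> sections F U \<Longrightarrow> \<phi> U s \<in> sections G U"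
    and "\<And>U V s. U \<in> carrier X \<Longrightarrow> V \<in> carrier X \<Longrightarrow> V \<sqsubseteq> U \<Longrightarrow> s \<in> sections F U \<Longrightarrow>
      \<phi> V (res F U V s) = res G U V (\<phi> U s)"
  shows "sheaf_map F G \<phi> \<in> Hom ShX F G"
  unfolding Sh_Hom_iff is_sheaf_morphism_def sheaf_map_def
  using assms restriction_closed[OF assms(1)] by (simp add: PiE_iff)

lemma
  assumes "\<eta> \<in> Hom ShX F G"
  shows source_sheaf: "Sheaf F" and target_sheaf: "Sheaf G"
    and component_closed: "U \<in> carrier X \<Longrightarrow> s \<in> sections F U \<Longrightarrow> component \<eta> U s \<in> sections G U"
    and component_natural: "U \<in> carrier X \<Longrightarrow> V \<in> carrier X \<Longrightarrow> V \<sqsubseteq> U \<Longrightarrow> s \<in> sections F U \<Longrightarrow>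
      component \<eta> V (res F U V s) = res G U V (component \<eta> U s)"
  using assms unfolding Sh_Hom_iff is_sheaf_morphism_def by (auto simp: PiE_iff)

lemma sheaf_morphism_eqI:
  assumes "\<eta> \<in> Hom ShX F G" "\<theta> \<in> Hom ShX F G"
    and eq: "\<And>U s. U \<in> carrier X \<Longrightarrow> s \<in> sections F U \<Longrightarrow> component \<eta> U s = component \<theta> U s"
  shows "\<eta> = \<theta>"
proof -
  have "component \<eta> = component \<theta>"
  proof (rule PiE_ext)
    show \<eta>: "component \<eta> \<in> (\<Pi>\<^sub>E U \<in> carrier X. sections F U \<rightarrow>\<^sub>E sections G U)"
      and \<theta>: "component \<theta> \<in> (\<Pi>\<^sub>E U \<in> carrier X. sections F U \<rightarrow>\<^sub>E sections G U)"
      using assms(1,2) unfolding Sh_Hom_iff is_sheaf_morphism_def by (elim conjE, simp)+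
    fix U assume U: "U \<in> carrier X"
    show "component \<eta> U = component \<theta> U"
      by (rule PiE_ext[OF PiE_mem[OF \<eta> U] PiE_mem[OF \<theta> U]]) (rule eq[OF U])
  qed
  then show ?thesis using assms(1,2) unfolding Sh_Hom_iff by simp
qed

lemma component_Comp:
  assumes "\<theta> \<in> Hom ShX F G" "U \<in> carrier X" "s \<in> sections F U"
  shows "component (\<eta> \<cdot>\<^bsub>ShX\<^esub> \<theta>) U s = component \<eta> U (component \<theta> U s)"
  using assms unfolding Sh_Hom_iff by (simp add: Sh_def)

lemma Sh_Comp_in_Hom:
  assumes \<theta>: "\<theta> \<in> Hom ShX F G" and \<eta>: "\<eta> \<in> Hom ShX G H"
  shows "\<eta> \<cdot>\<^bsub>ShX\<^esub> \<theta> \<in> Hom ShX F H"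
proof -
  have "\<eta> \<cdot>\<^bsub>ShX\<^esub> \<theta> = sheaf_map F H (\<lambda>U s. component \<eta> U (component \<theta> U s))"
    using \<theta> \<eta> unfolding Sh_Hom_iff sheaf_map_def by (simp add: Sh_def)
  also have "\<dots> \<in> Hom ShX F H"
    by (rule sheaf_map_in_Hom[OF source_sheaf[OF \<theta>] target_sheaf[OF \<eta>]])
      (simp_all add: component_closed[OF \<theta>] component_closed[OF \<eta>]
        component_natural[OF \<theta>] component_natural[OF \<eta>])
  finally show ?thesis .
qed

lemma Sh_Ident: "Ident ShX F = sheaf_map F F (\<lambda>U s. s)"
  unfolding Sh_def sheaf_map_def by simp

lemma Sh_category: "category ShX"
proof
  have id: "Ident ShX F \<in> Hom ShX F F" if "Sheaf F" for F
    unfolding Sh_Ident by (rule sheaf_map_in_Hom[OF that that]) auto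
  show "Dom ShX f \<in> Obj ShX" "Cod ShX f \<in> Obj ShX" if "f \<in> Arr ShX" for f
    using that unfolding Sh_def is_sheaf_morphism_def by auto
  show "Ident ShX A \<in> Hom ShX A A" if "A \<in> Obj ShX" for A
    using that id unfolding Sh_Obj by blast
  show "g \<cdot>\<^bsub>ShX\<^esub> f \<in> Hom ShX A D" if "f \<in> Hom ShX A B" "g \<in> Hom ShX B D" for f g A B D
    by (rule Sh_Comp_in_Hom[OF that])
  show "f \<cdot>\<^bsub>ShX\<^esub> Ident ShX A = f" if f: "f \<in> Hom ShX A B" for f A B
  proof (rule sheaf_morphism_eqI[OF Sh_Comp_in_Hom[OF id f] f])
    show A: "Sheaf A" by (rule source_sheaf[OF f])
    show "component (f \<cdot>\<^bsub>ShX\<^esub> Ident ShX A) U s = component f U s" if "U \<in> carrier X" "s \<in> sections A U" for U s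
      using component_Comp[OF id[OF A] that] that unfolding Sh_Ident by simp
  qed
  show "Ident ShX B \<cdot>\<^bsub>ShX\<^esub> f = f" if f: "f \<in> Hom ShX A B" for f A B
  proof (rule sheaf_morphism_eqI[OF Sh_Comp_in_Hom[OF f id] f])
    show B: "Sheaf B" by (rule target_sheaf[OF f])
    show "component (Ident ShX B \<cdot>\<^bsub>ShX\<^esub> f) U s = component f U s" if "U \<in> carrier X" "s \<in> sections A U" for U s
      using component_Comp[OF f that] that component_closed[OF f that] unfolding Sh_Ident by simp
  qed
  show "(h \<cdot>\<^bsub>ShX\<^esub> g) \<cdot>\<^bsub>ShX\<^esub> f = h \<cdot>\<^bsub>ShX\<^esub> (g \<cdot>\<^bsub>ShX\<^esub> f)"
    if f: "f \<in> Hom ShX A B" and g: "g \<in> Hom ShX B D" and h: "h \<in> Hom ShX D E" for f g h A B D E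
  proof (rule sheaf_morphism_eqI)
    show "(h \<cdot>\<^bsub>ShX\<^esub> g) \<cdot>\<^bsub>ShX\<^esub> f \<in> Hom ShX A E" "h \<cdot>\<^bsub>ShX\<^esub> (g \<cdot>\<^bsub>ShX\<^esub> f) \<in> Hom ShX A E"
      using f g h Sh_Comp_in_Hom by blast+
    fix U s assume "U \<in> carrier X" "s \<in> sections A U"
    then show "component ((h \<cdot>\<^bsub>ShX\<^esub> g) \<cdot>\<^bsub>ShX\<^esub> f) U s = component (h \<cdot>\<^bsub>ShX\<^esub> (g \<cdot>\<^bsub>ShX\<^esub> f)) U s"
      using component_Comp[OF f] component_Comp[OF g] component_Comp[OF Sh_Comp_in_Hom[OF f g]]
        component_closed[OF f] by simp
  qed
qed

sublocale Sh: category ShX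
  by (rule Sh_category)

text \<open>
  The morphism that corresponds to the section \<open>s\<close> under the Yoneda lemma.
\<close>

definition point :: "'u presheaf_data \<Rightarrow> 'u \<Rightarrow> 'u \<Rightarrow> 'u sheaf_morphism" where
  "point F U s = sheaf_map (restrict_to terminal_sheaf U) F (\<lambda>V _. res F U V s)"

lemma point_in_Hom:
  assumes "Sheaf F" "U \<in> carrier X" "s \<in> sections F U"
  shows "point F U s \<in> Hom ShX (restrict_to terminal_sheaf U) F"
  unfolding point_def
  by (rule sheaf_map_in_Hom[OF restrict_to_is_sheaf[OF terminal_sheaf_is_sheaf]])
    (use assms restriction_closed restriction_restriction in \<open>auto split: if_splits\<close>)

lemma component_point:
  "U \<in> carrier X \<Longrightarrow> V \<in> carrier X \<Longrightarrow> V \<sqsubseteq> U \<Longrightarrow> component (point F U s) V \<bottom> = res F U V s"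
  unfolding point_def by simp

lemma Comp_point:
  assumes \<eta>: "\<eta> \<in> Hom ShX F G" and U: "U \<in> carrier X" and s: "s \<in> sections F U"
  shows "\<eta> \<cdot>\<^bsub>ShX\<^esub> point F U s = point G U (component \<eta> U s)"
proof (rule sheaf_morphism_eqI)
  have p: "point F U s \<in> Hom ShX (restrict_to terminal_sheaf U) F"
    by (rule point_in_Hom[OF source_sheaf[OF \<eta>] U s])
  show "\<eta> \<cdot>\<^bsub>ShX\<^esub> point F U s \<in> Hom ShX (restrict_to terminal_sheaf U) G"
    by (rule Sh_Comp_in_Hom[OF p \<eta>])
  show "point G U (component \<eta> U s) \<in> Hom ShX (restrict_to terminal_sheaf U) G"
    by (rule point_in_Hom[OF target_sheaf[OF \<eta>] U component_closed[OF \<eta> U s]])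
  fix V t assume V: "V \<in> carrier X" and t: "t \<in> sections (restrict_to terminal_sheaf U) V"
  then have le: "V \<sqsubseteq> U" and t': "t = \<bottom>" by (auto split: if_splits)
  show "component (\<eta> \<cdot>\<^bsub>ShX\<^esub> point F U s) V t = component (point G U (component \<eta> U s)) V t"
    using component_Comp[OF p V t] component_natural[OF \<eta> U V le s] unfolding t'
    by (simp add: component_point U V le)
qed

lemma point_inject:
  assumes "Sheaf F" "U \<in> carrier X" "s \<in> sections F U" "t \<in> sections F U" "point F U s = point F U t"
  shows "s = t"
proof -
  have "res F U U s = res F U U t"
    using component_point[of U U F s] component_point[of U U F t] assms(2,5) by simp
  then show ?thesis using restriction_id[OF assms(1,2)] assms(3,4) by simp
qed

text \<open>
  Two sections over \<open>U\<close> with the same image are two morphisms from the sheaf represented by \<open>U\<close> that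
  become equal after composition with \<open>m\<close>.
\<close>

lemma mono_imp_injective:
  assumes m: "m \<in> Hom ShX A B" and mono: "monomorphism ShX m"
    and U: "U \<in> carrier X" and s: "s \<in> sections A U" and t: "t \<in> sections A U"
    and eq: "component m U s = component m U t"
  shows "s = t"
proof (rule point_inject[OF source_sheaf[OF m] U s t])
  note A = source_sheaf[OF m]
  show "point A U s = point A U t"
    by (rule Sh.monomorphismD[OF mono m point_in_Hom[OF A U s] point_in_Hom[OF A U t]])
      (simp add: Comp_point[OF m U s] Comp_point[OF m U t] eq)
qed

lemma injective_imp_mono:
  assumes m: "m \<in> Hom ShX A B"
    and inj: "\<And>U s t. U \<in> carrier X \<Longrightarrow> s \<in> sections A U \<Longrightarrow> t \<in> sections A U \<Longrightarrow>
      component m U s = component m U t \<Longrightarrow> s = t"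
  shows "monomorphism ShX m"
proof (rule Sh.monomorphismI[OF m])
  fix Z u v assume u: "u \<in> Hom ShX Z A" and v: "v \<in> Hom ShX Z A" and eq: "m \<cdot>\<^bsub>ShX\<^esub> u = m \<cdot>\<^bsub>ShX\<^esub> v"
  show "u = v"
  proof (rule sheaf_morphism_eqI[OF u v])
    fix U s assume U: "U \<in> carrier X" and s: "s \<in> sections Z U"
    show "component u U s = component v U s"
      by (rule inj[OF U component_closed[OF u U s] component_closed[OF v U s]])
        (metis component_Comp[OF u U s] component_Comp[OF v U s] eq)
  qed
qed

text \<open>
  Send a section \<open>q\<close> over \<open>U\<close> to the truth value \<open>\<chi> U q\<close> of its lying in the image of \<open>e\<close>, that is, to
  the join of all opens on which it has a preimage. This is a morphism \<open>Q \<rightarrow> \<Omega>\<close> that agrees with the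
  constant morphism \<open>true\<close> on the image of \<open>e\<close>. As \<open>e\<close> is an epimorphism the two are equal, and \<open>\<chi> U q = U\<close> is the
  claim.
\<close>

lemma epi_locally_surjective:
  assumes epi: "epimorphism ShX e" and e: "e \<in> Hom ShX P Q"
    and U: "U \<in> carrier X" and q: "q \<in> sections Q U"
  shows "covers U (\<lambda>V. \<exists>p \<in> sections P V. component e V p = res Q U V q)"
proof -
  note Q = target_sheaf[OF e] and P = source_sheaf[OF e]
  let ?hit = "\<lambda>U q V. \<exists>p \<in> sections P V. component e V p = res Q U V q"
  define \<chi> where "\<chi> U q = \<Squnion> {V \<in> carrier X. V \<sqsubseteq> U \<and> ?hit U q V}" for U q
  have \<chi>_closed: "\<chi> U q \<in> carrier X" for U q
    unfolding \<chi>_def by (rule sup_closed) blast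
  have \<chi>_le: "\<chi> U q \<sqsubseteq> U" if "U \<in> carrier X" for U q
    unfolding \<chi>_def by (rule sup_least) (use that in auto)
  have \<chi>_ge: "V \<sqsubseteq> \<chi> U q" if "V \<in> carrier X" "V \<sqsubseteq> U" "?hit U q V" for U q V
    unfolding \<chi>_def by (rule sup_upper) (use that in auto)
  have hit_down: "?hit U q W"
    if "U \<in> carrier X" "V \<in> carrier X" "W \<in> carrier X" "V \<sqsubseteq> U" "W \<sqsubseteq> V" "q \<in> sections Q U" and hit: "?hit U q V"
    for U V W q
  proof -
    obtain p where p: "p \<in> sections P V" "component e V p = res Q U V q" using hit by blast
    have "component e W (res P V W p) = res Q U W q"
      using component_natural[OF e that(2,3,5) p(1)] p(2)
        restriction_restriction[OF Q that(1,2,3,5,4,6)] by simp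
    then show ?thesis using restriction_closed[OF P that(2,3,5) p(1)] by blast
  qed
  have \<chi>_natural: "\<chi> W (res Q U W q) = W \<sqinter> \<chi> U q"
    if U: "U \<in> carrier X" and W: "W \<in> carrier X" "W \<sqsubseteq> U" and q: "q \<in> sections Q U" for U W q
  proof (rule le_antisym)
    have hit_iff: "?hit W (res Q U W q) V \<longleftrightarrow> ?hit U q V" if "V \<in> carrier X" "V \<sqsubseteq> W" for V
      using restriction_restriction[OF Q U W(1) that W(2) q] by simp
    show "\<chi> W (res Q U W q) \<in> carrier X" "W \<sqinter> \<chi> U q \<in> carrier X" using W \<chi>_closed by auto
    show "\<chi> W (res Q U W q) \<sqsubseteq> W \<sqinter> \<chi> U q"
    proof (rule meet_le[OF \<chi>_le[OF W(1)] _ W(1) \<chi>_closed \<chi>_closed])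
      show "\<chi> W (res Q U W q) \<sqsubseteq> \<chi> U q"
        unfolding \<chi>_def[of W]
      proof (rule sup_least)
        fix V assume "V \<in> {V \<in> carrier X. V \<sqsubseteq> W \<and> ?hit W (res Q U W q) V}"
        then have V: "V \<in> carrier X" "V \<sqsubseteq> W" and "?hit W (res Q U W q) V" by simp_all
        then have "?hit U q V" using hit_iff by blast
        then show "V \<sqsubseteq> \<chi> U q"
          by (rule \<chi>_ge[OF V(1) le_trans[OF V(2) W(2) V(1) W(1) U]])
      qed (use \<chi>_closed in auto)
    qed
    let ?S = "{V \<in> carrier X. V \<sqsubseteq> U \<and> ?hit U q V}"
    have S: "?S \<subseteq> carrier X" by blast
    have "W \<sqinter> \<chi> U q = \<Squnion> ((\<lambda>V. W \<sqinter> V) ` ?S)"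
      unfolding \<chi>_def by (rule meet_Sup_distrib[OF W(1) S])
    also have "\<dots> \<sqsubseteq> \<chi> W (res Q U W q)"
    proof (rule sup_least)
      show "(\<lambda>V. W \<sqinter> V) ` ?S \<subseteq> carrier X" using W(1) by auto
      fix Y assume "Y \<in> (\<lambda>V. W \<sqinter> V) ` ?S"
      then obtain V where V: "V \<in> carrier X" "V \<sqsubseteq> U" "?hit U q V" and Y: "Y = W \<sqinter> V" by blast
      have c: "W \<sqinter> V \<in> carrier X" "W \<sqinter> V \<sqsubseteq> W" "W \<sqinter> V \<sqsubseteq> V"
        using V W by (auto simp: meet_left meet_right)
      have "?hit U q (W \<sqinter> V)" by (rule hit_down[OF U V(1) c(1) V(2) c(3) q V(3)])
      then show "Y \<sqsubseteq> \<chi> W (res Q U W q)"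
        unfolding Y using hit_iff[OF c(1,2)] by (intro \<chi>_ge[OF c(1,2)]) blast
    qed (rule \<chi>_closed)
    finally show "W \<sqinter> \<chi> U q \<sqsubseteq> \<chi> W (res Q U W q)" .
  qed
  define c t where "c = sheaf_map Q Omega \<chi>" and "t = sheaf_map Q Omega (\<lambda>U _. U)"
  have c: "c \<in> Hom ShX Q Omega"
    unfolding c_def by (rule sheaf_map_in_Hom[OF Q Omega_is_sheaf]) (auto simp: \<chi>_closed \<chi>_le \<chi>_natural)
  have t: "t \<in> Hom ShX Q Omega"
    unfolding t_def by (rule sheaf_map_in_Hom[OF Q Omega_is_sheaf])
      (simp_all add: meet_absorb)
  have "c \<cdot>\<^bsub>ShX\<^esub> e = t \<cdot>\<^bsub>ShX\<^esub> e"
  proof (rule sheaf_morphism_eqI[OF Sh_Comp_in_Hom[OF e c] Sh_Comp_in_Hom[OF e t]])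
    fix V p assume V: "V \<in> carrier X" and p: "p \<in> sections P V"
    note ep = component_closed[OF e V p]
    have "\<chi> V (component e V p) = V"
      by (rule le_antisym[OF \<chi>_le[OF V] \<chi>_ge \<chi>_closed V])
        (use V p restriction_id[OF Q V ep] in auto)
    then show "component (c \<cdot>\<^bsub>ShX\<^esub> e) V p = component (t \<cdot>\<^bsub>ShX\<^esub> e) V p"
      using component_Comp[OF e V p] V ep unfolding c_def t_def by simp
  qed
  then have "c = t" by (rule Sh.epimorphismD[OF epi e c t])
  then have "\<chi> U q = U" using component_sheaf_map[OF U q] unfolding c_def t_def by metis
  then show ?thesis using U unfolding covers_def \<chi>_def by blast
qed

section \<open>Extending sheaf morphisms\<close>

text \<open>
  The graph of a function on a subpresheaf of \<open>B\<close> with values in \<open>J\<close>. With a subpresheaf as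
  domain, the union of a chain of partial maps is again one, without sheafification.
\<close>

definition partial_map :: "'u presheaf_data \<Rightarrow> 'u presheaf_data \<Rightarrow> ('u \<times> 'u \<times> 'u) set \<Rightarrow> bool" where
  "partial_map B J M \<longleftrightarrow>
    (\<forall>U s t. (U, s, t) \<in> M \<longrightarrow> U \<in> carrier X \<and> s \<in> sections B U \<and> t \<in> sections J U) \<and>
    (\<forall>U s t V. (U, s, t) \<in> M \<longrightarrow> V \<in> carrier X \<longrightarrow> V \<sqsubseteq> U \<longrightarrow> (V, res B U V s, res J U V t) \<in> M) \<and>
    (\<forall>U s t t'. (U, s, t) \<in> M \<longrightarrow> (U, s, t') \<in> M \<longrightarrow> t = t')"

lemma partial_mapD:
  assumes "partial_map B J M"
  shows "(U, s, t) \<in> M \<Longrightarrow> U \<in> carrier X" "(U, s, t) \<in> M \<Longrightarrow> s \<in> sections B U"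
    "(U, s, t) \<in> M \<Longrightarrow> t \<in> sections J U"
    "(U, s, t) \<in> M \<Longrightarrow> V \<in> carrier X \<Longrightarrow> V \<sqsubseteq> U \<Longrightarrow> (V, res B U V s, res J U V t) \<in> M"
    "(U, s, t) \<in> M \<Longrightarrow> (U, s, t') \<in> M \<Longrightarrow> t = t'"
  using assms unfolding partial_map_def by blast+

definition maximal_partial_map :: "'u presheaf_data \<Rightarrow> 'u presheaf_data \<Rightarrow> ('u \<times> 'u \<times> 'u) set \<Rightarrow> bool" where
  "maximal_partial_map B J M \<longleftrightarrow> partial_map B J M \<and>
    (\<forall>N. partial_map B J N \<longrightarrow> M \<subseteq> N \<longrightarrow> N = M)"

text \<open>
  Zorn's lemma. Two pairs in the union of a chain lie in a common member, so the union is functional.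
\<close>

lemma maximal_partial_map_exists:
  assumes "partial_map B J M0"
  obtains M where "maximal_partial_map B J M" "M0 \<subseteq> M"
proof -
  let ?A = "{M. partial_map B J M \<and> M0 \<subseteq> M}"
  have "\<exists>M\<in>?A. \<forall>N\<in>?A. M \<subseteq> N \<longrightarrow> N = M"
  proof (rule subset_Zorn_nonempty)
    show "?A \<noteq> {}" using assms by blast
    fix \<C> assume ne: "\<C> \<noteq> {}" and chain: "subset.chain ?A \<C>"
    have sub: "\<And>M. M \<in> \<C> \<Longrightarrow> partial_map B J M \<and> M0 \<subseteq> M"
      and tot: "\<And>M N. M \<in> \<C> \<Longrightarrow> N \<in> \<C> \<Longrightarrow> M \<subseteq> N \<or> N \<subseteq> M"
      using chain unfolding subset_chain_def by blast+
    have "partial_map B J (\<Union>\<C>)"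
      unfolding partial_map_def
    proof (intro conjI allI impI)
      fix U s t t' assume "(U, s, t) \<in> \<Union>\<C>" "(U, s, t') \<in> \<Union>\<C>"
      then obtain M N where "M \<in> \<C>" "N \<in> \<C>" "(U, s, t) \<in> M" "(U, s, t') \<in> N" by blast
      then obtain M' where "M' \<in> \<C>" "(U, s, t) \<in> M'" "(U, s, t') \<in> M'" using tot[of M N] by blast
      then show "t = t'" using partial_mapD(5)[of B J M'] sub by blast
    next
      fix U s t assume "(U, s, t) \<in> \<Union>\<C>"
      then obtain M where M: "M \<in> \<C>" and m: "(U, s, t) \<in> M" by blast
      have pm: "partial_map B J M" using sub[OF M] by blast
      show "U \<in> carrier X" "s \<in> sections B U" "t \<in> sections J U"
        by (rule partial_mapD(1-3)[OF pm m])+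
      fix V assume "V \<in> carrier X" "V \<sqsubseteq> U"
      then show "(V, res B U V s, res J U V t) \<in> \<Union>\<C>" using partial_mapD(4)[OF pm m] M by blast
    qed
    then show "\<Union>\<C> \<in> ?A" using \<open>partial_map B J (\<Union>\<C>)\<close> ne sub by (simp add: less_eq_Sup)
  qed
  then obtain M where "M \<in> ?A" and max: "\<forall>N\<in>?A. M \<subseteq> N \<longrightarrow> N = M" by (rule bexE)
  then have M: "partial_map B J M" "M0 \<subseteq> M" by simp_all
  show thesis
  proof (rule that[OF _ M(2)])
    show "maximal_partial_map B J M"
      unfolding maximal_partial_map_def using M max by auto
  qed
qed

text \<open>
  Adding to \<open>M\<close> all pairs that belong to it locally gives a partial map: it is functional because \<open>J\<close> is
  separated, and two local memberships have a common refinement. By maximality nothing new was added.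
\<close>

lemma maximal_partial_map_local:
  assumes B: "Sheaf B" and J: "Sheaf J" and max: "maximal_partial_map B J M"
    and s: "s \<in> sections B U" and t: "t \<in> sections J U"
    and cov: "covers U (\<lambda>V. (V, res B U V s, res J U V t) \<in> M)"
  shows "(U, s, t) \<in> M"
proof -
  have M: "partial_map B J M" using max unfolding maximal_partial_map_def by blast
  define N where "N = {(U, s, t). s \<in> sections B U \<and> t \<in> sections J U \<and>
    covers U (\<lambda>V. (V, res B U V s, res J U V t) \<in> M)}"
  have down: "(W, res B U W s, res J U W t) \<in> M"
    if "U \<in> carrier X" "V \<in> carrier X" "V \<sqsubseteq> U" "W \<in> carrier X" "W \<sqsubseteq> V"
      "s \<in> sections B U" "t \<in> sections J U" "(V, res B U V s, res J U V t) \<in> M" for U V W s t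
    using partial_mapD(4)[OF M that(8,4,5)] restriction_restriction[OF B that(1,2,4,5,3,6)]
      restriction_restriction[OF J that(1,2,4,5,3,7)] by simp
  have "partial_map B J N"
    unfolding partial_map_def
  proof (intro conjI allI impI)
    fix U s t assume "(U, s, t) \<in> N"
    then have s: "s \<in> sections B U" and t: "t \<in> sections J U"
      and cov: "covers U (\<lambda>V. (V, res B U V s, res J U V t) \<in> M)" unfolding N_def by auto
    note U = covers_carrier[OF cov]
    show "U \<in> carrier X" "s \<in> sections B U" "t \<in> sections J U" by fact+
    fix W assume W: "W \<in> carrier X" "W \<sqsubseteq> U"
    have "covers W (\<lambda>V. (V, res B U V s, res J U V t) \<in> M)"
      by (rule covers_restrict[OF cov W])
        (use down[OF U _ _ _ _ s t] W meet_closed meet_right in blast)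
    then have "covers W (\<lambda>V. (V, res B W V (res B U W s), res J W V (res J U W t)) \<in> M)"
      by (rule covers_mono)
        (simp add: restriction_restriction[OF B U W(1) _ _ W(2) s] restriction_restriction[OF J U W(1) _ _ W(2) t])
    then show "(W, res B U W s, res J U W t) \<in> N"
      unfolding N_def using restriction_closed[OF B U W s] restriction_closed[OF J U W t] by simp
  next
    fix U s t t' assume "(U, s, t) \<in> N" "(U, s, t') \<in> N"
    then have s: "s \<in> sections B U" and t: "t \<in> sections J U" and t': "t' \<in> sections J U"
      and cov: "covers U (\<lambda>V. (V, res B U V s, res J U V t) \<in> M)"
      and cov': "covers U (\<lambda>V. (V, res B U V s, res J U V t') \<in> M)" unfolding N_def by auto
    note U = covers_carrier[OF cov]
    have "covers U (\<lambda>V. (V, res B U V s, res J U V t) \<in> M \<and> (V, res B U V s, res J U V t') \<in> M)"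
      by (rule covers_conj[OF cov cov']) (use down[OF U _ _ _ _ s] t t' in blast)+
    then have "covers U (\<lambda>V. res J U V t = res J U V t')"
      by (rule covers_mono) (use partial_mapD(5)[OF M] in blast)
    then show "t = t'" by (rule sheaf_separated[OF J t t'])
  qed
  moreover have "M \<subseteq> N"
  proof
    fix x assume "x \<in> M"
    then obtain U s t where x: "x = (U, s, t)" and m: "(U, s, t) \<in> M" by (cases x) auto
    note U = partial_mapD(1)[OF M m] and s = partial_mapD(2)[OF M m] and t = partial_mapD(3)[OF M m]
    have "covers U (\<lambda>V. (V, res B U V s, res J U V t) \<in> M)"
      by (rule covers_self[OF U]) (simp add: restriction_id[OF B U s] restriction_id[OF J U t] m)
    then show "x \<in> N" unfolding N_def x using s t by simp
  qed
  ultimately have "N = M" using max unfolding maximal_partial_map_def by blast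
  then show ?thesis using s t cov unfolding N_def by blast
qed

text \<open>
  The local values of the partial map are unique, hence compatible, and glue to a value in \<open>J\<close>. The glued pair
  belongs to \<open>M\<close> locally, hence belongs to \<open>M\<close>.
\<close>

lemma maximal_partial_map_domain_local:
  assumes B: "Sheaf B" and J: "Sheaf J" and max: "maximal_partial_map B J M"
    and s: "s \<in> sections B U" and cov: "covers U (\<lambda>V. \<exists>t. (V, res B U V s, t) \<in> M)"
  shows "\<exists>t. (U, s, t) \<in> M"
proof -
  note U = covers_carrier[OF cov]
  have M: "partial_map B J M" using max unfolding maximal_partial_map_def by blast
  define \<sigma> where "\<sigma> = (\<lambda>V. SOME t. (V, res B U V s, t) \<in> M)"
  have \<sigma>: "(V, res B U V s, \<sigma> V) \<in> M" if "\<exists>t. (V, res B U V s, t) \<in> M" for V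
    unfolding \<sigma>_def by (rule someI_ex[OF that])
  have \<sigma>_res: "(Y, res B U Y s, res J V Y (\<sigma> V)) \<in> M"
    if "V \<in> carrier X" "V \<sqsubseteq> U" "\<exists>t. (V, res B U V s, t) \<in> M" "Y \<in> carrier X" "Y \<sqsubseteq> V" for V Y
    using partial_mapD(4)[OF M \<sigma>[OF that(3)] that(4,5)]
      restriction_restriction[OF B U that(1,4,5,2) s] by simp
  have "\<exists>t \<in> sections J U. \<forall>V \<in> carrier X. V \<sqsubseteq> U \<longrightarrow> (\<exists>t. (V, res B U V s, t) \<in> M) \<longrightarrow>
      res J U V t = \<sigma> V"
  proof (rule sheaf_glue[OF J cov])
    show "\<sigma> V \<in> sections J V" if "\<exists>t. (V, res B U V s, t) \<in> M" for V
      by (rule partial_mapD(3)[OF M \<sigma>[OF that]])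
    fix V W
    assume V: "V \<in> carrier X" "V \<sqsubseteq> U" "\<exists>t. (V, res B U V s, t) \<in> M"
      and W: "W \<in> carrier X" "W \<sqsubseteq> U" "\<exists>t. (W, res B U W s, t) \<in> M"
    show "res J V (V \<sqinter> W) (\<sigma> V) = res J W (V \<sqinter> W) (\<sigma> W)"
      by (rule partial_mapD(5)[OF M \<sigma>_res[OF V] \<sigma>_res[OF W]])
        (use V W meet_left meet_right in auto)
  qed
  then obtain t where t: "t \<in> sections J U"
    and res_t: "\<And>V. V \<in> carrier X \<Longrightarrow> V \<sqsubseteq> U \<Longrightarrow> (\<exists>t. (V, res B U V s, t) \<in> M) \<Longrightarrow> res J U V t = \<sigma> V"
    by blast
  have "covers U (\<lambda>V. (V, res B U V s, res J U V t) \<in> M)"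
    by (rule covers_mono[OF cov]) (use res_t \<sigma> in auto)
  then have "(U, s, t) \<in> M" by (rule maximal_partial_map_local[OF B J max s t])
  then show ?thesis ..
qed

text \<open>
  A partial map may be joined with a map defined on all of \<open>B|V\<close>, provided that the two agree on the common domain;
  agreement is only needed over opens below \<open>V\<close>.
\<close>

lemma partial_map_union:
  assumes M: "partial_map B J M" and B: "Sheaf B" and V: "V \<in> carrier X"
    and r: "r \<in> Hom ShX (restrict_to B V) J"
    and agree: "\<And>W s t. (W, s, t) \<in> M \<Longrightarrow> W \<sqsubseteq> V \<Longrightarrow> component r W s = t"
  shows "partial_map B J (M \<union> {(W, s, component r W s) | W s. W \<in> carrier X \<and> W \<sqsubseteq> V \<and> s \<in> sections B W})"
    (is "partial_map B J (M \<union> ?R)")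
proof -
  have r1: "component r W s \<in> sections J W" if "W \<in> carrier X" "W \<sqsubseteq> V" "s \<in> sections B W" for W s
    using component_closed[OF r that(1)] that by simp
  have r2: "component r Y (res B W Y s) = res J W Y (component r W s)"
    if "W \<in> carrier X" "W \<sqsubseteq> V" "s \<in> sections B W" "Y \<in> carrier X" "Y \<sqsubseteq> W" for W Y s
    using component_natural[OF r that(1,4,5)] that by simp
  have R: "(W, s, t) \<in> ?R \<longleftrightarrow> W \<in> carrier X \<and> W \<sqsubseteq> V \<and> s \<in> sections B W \<and> t = component r W s"
    for W s t by blast
  show ?thesis
    unfolding partial_map_def
  proof (intro conjI allI impI)
    fix W s t assume m: "(W, s, t) \<in> M \<union> ?R"
    show W: "W \<in> carrier X" and s: "s \<in> sections B W" using m partial_mapD[OF M] unfolding Un_iff R by blast+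
    show "t \<in> sections J W" using m partial_mapD[OF M] r1 unfolding Un_iff R by blast
    fix Y assume Y: "Y \<in> carrier X" "Y \<sqsubseteq> W"
    have "Y \<sqsubseteq> V" if "W \<sqsubseteq> V" by (rule le_trans[OF Y(2) that Y(1) W V])
    then show "(Y, res B W Y s, res J W Y t) \<in> M \<union> ?R"
      using m partial_mapD(4)[OF M _ Y] r2[OF W _ s Y] restriction_closed[OF B W Y s] Y
      unfolding Un_iff R by metis
  next
    fix W s t t' assume "(W, s, t) \<in> M \<union> ?R" "(W, s, t') \<in> M \<union> ?R"
    then show "t = t'" using partial_mapD(5)[OF M] agree unfolding Un_iff R by metis
  qed
qed

text \<open>
  Extend the graph of \<open>f\<close> to a maximal partial map \<open>M\<close> and let \<open>A'\<close> be its domain. The local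
  solutions of the extension problem for the inclusion \<open>n\<close> of \<open>A'\<close> into \<open>B\<close> show that \<open>A'\<close> is all of \<open>B\<close>.
\<close>

lemma extends_over_epis_imp_extends:
  assumes ext: "extends_over_epis ShX J"
    and m: "m \<in> Hom ShX A B" and mono: "monomorphism ShX m" and f: "f \<in> Hom ShX A J"
  shows "\<exists>g \<in> Hom ShX B J. g \<cdot>\<^bsub>ShX\<^esub> m = f"
proof -
  note A = source_sheaf[OF m] and B = target_sheaf[OF m] and J = target_sheaf[OF f]
  \<comment> \<open>The graph of \<open>f\<close> along \<open>m\<close>; it is functional because monomorphisms are injective on sections.\<close>
  define M0 where "M0 = {(U, component m U a, component f U a) | U a. U \<in> carrier X \<and> a \<in> sections A U}"
  have M0: "(U, s, t) \<in> M0 \<longleftrightarrow> (\<exists>a. U \<in> carrier X \<and> a \<in> sections A U \<and> s = component m U a \<and> t = component f U a)"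
    for U s t unfolding M0_def by blast
  have "partial_map B J M0"
    unfolding partial_map_def
  proof (intro conjI allI impI)
    fix U s t assume "(U, s, t) \<in> M0"
    then obtain a where U: "U \<in> carrier X" and a: "a \<in> sections A U"
      and st: "s = component m U a" "t = component f U a" unfolding M0 by blast
    show "U \<in> carrier X" "s \<in> sections B U" "t \<in> sections J U"
      unfolding st using U component_closed[OF m U a] component_closed[OF f U a] by auto
    fix V assume V: "V \<in> carrier X" "V \<sqsubseteq> U"
    show "(V, res B U V s, res J U V t) \<in> M0"
      unfolding M0 st using V restriction_closed[OF A U V a] component_natural[OF m U V a]
        component_natural[OF f U V a] by auto
  next
    fix U s t t' assume "(U, s, t) \<in> M0" "(U, s, t') \<in> M0"
    then show "t = t'" unfolding M0 using mono_imp_injective[OF m mono] by blast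
  qed
  then obtain M where max: "maximal_partial_map B J M" and M0M: "M0 \<subseteq> M"
    by (rule maximal_partial_map_exists)
  have M: "partial_map B J M" using max unfolding maximal_partial_map_def by blast
  note domain_local = maximal_partial_map_domain_local[OF B J max]
  define D where "D = (\<lambda>U. {s. \<exists>t. (U, s, t) \<in> M})"
  define h where "h = (\<lambda>U s. SOME t. (U, s, t) \<in> M)"
  have h: "(U, s, h U s) \<in> M" if "s \<in> D U" for U s
    unfolding h_def using that unfolding D_def by (auto intro: someI)
  have h_eq: "h U s = t" if "(U, s, t) \<in> M" for U s t
    by (rule partial_mapD(5)[OF M h that]) (use that D_def in blast)
  have D_sub: "D U \<subseteq> sections B U" for U using partial_mapD(2)[OF M] unfolding D_def by blast
  define A' where "A' = subsheaf B D"
  have A': "Sheaf A'"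
    unfolding A'_def
  proof (rule subsheaf_is_sheaf[OF B D_sub])
    show "res B U V s \<in> D V" if "V \<in> carrier X" "V \<sqsubseteq> U" "s \<in> D U" for U V s
      using partial_mapD(4)[OF M h[OF that(3)] that(1,2)] unfolding D_def by blast
    show "s \<in> D U" if "s \<in> sections B U" "covers U (\<lambda>V. res B U V s \<in> D V)" for U s
      using domain_local[OF that(1)] that(2) unfolding D_def by simp
  qed
  have A'_simps: "sections A' = D" "restriction A' = restriction B" unfolding A'_def by simp_all
  define n where "n = sheaf_map A' B (\<lambda>U s. s)"
  have n: "n \<in> Hom ShX A' B"
    unfolding n_def by (rule sheaf_map_in_Hom[OF A' B]) (use D_sub in \<open>auto simp: A'_simps\<close>)
  have n_comp: "component n U s = s" if "U \<in> carrier X" "s \<in> D U" for U s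
    unfolding n_def using component_sheaf_map[OF that(1), of s A'] that(2) by (simp add: A'_simps)
  have n_mono: "monomorphism ShX n"
    by (rule injective_imp_mono[OF n]) (simp add: A'_simps n_comp)
  define f' where "f' = sheaf_map A' J h"
  have f': "f' \<in> Hom ShX A' J"
    unfolding f'_def
  proof (rule sheaf_map_in_Hom[OF A' J], unfold A'_simps)
    show "h U s \<in> sections J U" if "s \<in> D U" for U s by (rule partial_mapD(3)[OF M h[OF that]])
    show "h V (res B U V s) = res J U V (h U s)" if "V \<in> carrier X" "V \<sqsubseteq> U" "s \<in> D U" for U V s
      by (rule h_eq[OF partial_mapD(4)[OF M h[OF that(3)] that(1,2)]])
  qed
  have T: "terminal_sheaf \<in> Obj ShX" using terminal_sheaf_is_sheaf Sh_Obj by blast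
  obtain P Q e k where epi: "epimorphism ShX e" and e: "e \<in> Hom ShX P Q"
    and k: "k \<in> Hom ShX terminal_sheaf Q"
    and sol: "\<And>Z \<psi> y b. \<psi> \<in> Hom ShX Z P \<Longrightarrow> y \<in> Hom ShX Z terminal_sheaf \<Longrightarrow> b \<in> Hom ShX Z B \<Longrightarrow>
      e \<cdot>\<^bsub>ShX\<^esub> \<psi> = k \<cdot>\<^bsub>ShX\<^esub> y \<Longrightarrow>
      \<exists>r \<in> Hom ShX Z J. \<forall>Z' z a. z \<in> Hom ShX Z' Z \<longrightarrow> a \<in> Hom ShX Z' A' \<longrightarrow>
        b \<cdot>\<^bsub>ShX\<^esub> z = n \<cdot>\<^bsub>ShX\<^esub> a \<longrightarrow> r \<cdot>\<^bsub>ShX\<^esub> z = f' \<cdot>\<^bsub>ShX\<^esub> a"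
    using ext[unfolded extends_over_epis_def, rule_format, OF n_mono n f' T] by blast
  note P = source_sheaf[OF e] and Q = target_sheaf[OF e]
  define q where "q = component k \<top> \<bottom>"
  have q: "q \<in> sections Q \<top>" unfolding q_def by (rule component_closed[OF k]) auto
  have k_comp: "component k W \<bottom> = res Q \<top> W q" if "W \<in> carrier X" for W
    using component_natural[OF k _ that, of \<top> \<bottom>] that top_higher unfolding q_def by simp
  \<comment> \<open>Here \<open>k\<close> acts as the name of the partial map, and \<open>q\<close> is the global section it picks out.
    Over every open on which \<open>q\<close> has a preimage under \<open>e\<close>, the partial map is total.\<close>
  have full_over: "s \<in> D W"
    if V: "V \<in> carrier X" and p: "p \<in> sections P V" and ep: "component e V p = res Q \<top> V q"
      and W: "W \<in> carrier X" "W \<sqsubseteq> V" and s: "s \<in> sections B W" for V p W s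
  proof -
    define Z where "Z = restrict_to B V"
    have Z: "Sheaf Z" unfolding Z_def by (rule restrict_to_is_sheaf[OF B V])
    have Z_sec: "s \<in> sections Z W \<longleftrightarrow> W \<sqsubseteq> V \<and> s \<in> sections B W" for W s unfolding Z_def by simp
    have Z_res: "restriction Z = restriction B" unfolding Z_def by simp
    define \<psi> where "\<psi> = sheaf_map Z P (\<lambda>W _. res P V W p)"
    have \<psi>: "\<psi> \<in> Hom ShX Z P"
      unfolding \<psi>_def
      by (rule sheaf_map_in_Hom[OF Z P])
        (auto simp: Z_sec restriction_closed[OF P V _ _ p] restriction_restriction[OF P V _ _ _ _ p])
    define y where "y = sheaf_map Z terminal_sheaf (\<lambda>_ _. \<bottom>)"
    have y: "y \<in> Hom ShX Z terminal_sheaf"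
      unfolding y_def by (rule sheaf_map_in_Hom[OF Z terminal_sheaf_is_sheaf]) auto
    define b where "b = sheaf_map Z B (\<lambda>_ s. s)"
    have b: "b \<in> Hom ShX Z B"
      unfolding b_def by (rule sheaf_map_in_Hom[OF Z B]) (auto simp: Z_sec Z_res)
    have "e \<cdot>\<^bsub>ShX\<^esub> \<psi> = k \<cdot>\<^bsub>ShX\<^esub> y"
    proof (rule sheaf_morphism_eqI[OF Sh_Comp_in_Hom[OF \<psi> e] Sh_Comp_in_Hom[OF y k]])
      fix W s assume W: "W \<in> carrier X" and s: "s \<in> sections Z W"
      then have le: "W \<sqsubseteq> V" unfolding Z_sec by blast
      have "component (e \<cdot>\<^bsub>ShX\<^esub> \<psi>) W s = component e W (res P V W p)"
        using component_Comp[OF \<psi> W s] component_sheaf_map[OF W s] unfolding \<psi>_def by simp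
      also have "\<dots> = res Q V W (res Q \<top> V q)"
        using component_natural[OF e V W le p] ep by simp
      also have "\<dots> = res Q \<top> W q"
        using restriction_restriction[OF Q _ V W le _ q] V top_higher by simp
      also have "\<dots> = component (k \<cdot>\<^bsub>ShX\<^esub> y) W s"
        using component_Comp[OF y W s] component_sheaf_map[OF W s] k_comp[OF W] unfolding y_def by simp
      finally show "component (e \<cdot>\<^bsub>ShX\<^esub> \<psi>) W s = component (k \<cdot>\<^bsub>ShX\<^esub> y) W s" .
    qed
    from sol[OF \<psi> y b this] obtain r where r: "r \<in> Hom ShX Z J"
      and r_ext: "\<And>Z' z a. z \<in> Hom ShX Z' Z \<Longrightarrow> a \<in> Hom ShX Z' A' \<Longrightarrow>
        b \<cdot>\<^bsub>ShX\<^esub> z = n \<cdot>\<^bsub>ShX\<^esub> a \<Longrightarrow> r \<cdot>\<^bsub>ShX\<^esub> z = f' \<cdot>\<^bsub>ShX\<^esub> a" by blast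
    \<comment> \<open>The element of \<open>B|V\<close> given by \<open>s\<close> comes from \<open>A'\<close>, so there \<open>r\<close> has the value of the partial map.\<close>
    have agree: "component r W s = t" if m: "(W, s, t) \<in> M" and le: "W \<sqsubseteq> V" for W s t
    proof -
      note W = partial_mapD(1)[OF M m]
      have sD: "s \<in> D W" using m unfolding D_def by blast
      have sZ: "s \<in> sections Z W" using sD D_sub le unfolding Z_sec by blast
      have sA: "s \<in> sections A' W" using sD unfolding A'_simps .
      have "component b W s = component n W s"
        using component_sheaf_map[OF W sZ] n_comp[OF W sD] unfolding b_def by simp
      then have "b \<cdot>\<^bsub>ShX\<^esub> point Z W s = n \<cdot>\<^bsub>ShX\<^esub> point A' W s"
        using Comp_point[OF b W sZ] Comp_point[OF n W sA] by simp
      then have "r \<cdot>\<^bsub>ShX\<^esub> point Z W s = f' \<cdot>\<^bsub>ShX\<^esub> point A' W s"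
        by (rule r_ext[OF point_in_Hom[OF Z W sZ] point_in_Hom[OF A' W sA]])
      then have "point J W (component r W s) = point J W (component f' W s)"
        using Comp_point[OF r W sZ] Comp_point[OF f' W sA] by simp
      then have "component r W s = component f' W s"
        by (rule point_inject[OF J W component_closed[OF r W sZ] component_closed[OF f' W sA]])
      also have "\<dots> = t" using component_sheaf_map[OF W sA] h_eq[OF m] unfolding f'_def by simp
      finally show ?thesis .
    qed
    \<comment> \<open>Maximality of \<open>M\<close> shows that \<open>r\<close> adds nothing to it.\<close>
    have "M \<union> {(W, s, component r W s) | W s. W \<in> carrier X \<and> W \<sqsubseteq> V \<and> s \<in> sections B W} = M"
      using max partial_map_union[OF M B V r[unfolded Z_def] agree]
      unfolding maximal_partial_map_def by blast
    then show ?thesis using W s unfolding D_def by blast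
  qed
  have D: "D U = sections B U" if U: "U \<in> carrier X" for U
  proof
    show "D U \<subseteq> sections B U" by (rule D_sub)
    show "sections B U \<subseteq> D U"
    proof
      fix s assume s: "s \<in> sections B U"
      have "covers \<top> (\<lambda>V. \<exists>p \<in> sections P V. component e V p = res Q \<top> V q)"
        by (rule epi_locally_surjective[OF epi e _ q]) simp
      then have "covers U (\<lambda>V. \<exists>t. (V, res B U V s, t) \<in> M)"
      proof (rule covers_restrict[OF _ U])
        show "U \<sqsubseteq> \<top>" using U by (rule top_higher)
        fix V assume V: "V \<in> carrier X" "\<exists>p \<in> sections P V. component e V p = res Q \<top> V q"
        then obtain p where p: "p \<in> sections P V" "component e V p = res Q \<top> V q" by blast
        have c: "U \<sqinter> V \<in> carrier X" "U \<sqinter> V \<sqsubseteq> V" "U \<sqinter> V \<sqsubseteq> U"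
          using U V by (auto simp: meet_left meet_right)
        have "res B U (U \<sqinter> V) s \<in> D (U \<sqinter> V)"
          by (rule full_over[OF V(1) p c(1,2) restriction_closed[OF B U c(1,3) s]])
        then show "\<exists>t. (U \<sqinter> V, res B U (U \<sqinter> V) s, t) \<in> M" unfolding D_def by blast
      qed
      then show "s \<in> D U" using domain_local[OF s] unfolding D_def by blast
    qed
  qed
  define g where "g = sheaf_map B J h"
  have g: "g \<in> Hom ShX B J"
    unfolding g_def
  proof (rule sheaf_map_in_Hom[OF B J])
    show "h U s \<in> sections J U" if "U \<in> carrier X" "s \<in> sections B U" for U s
      using partial_mapD(3)[OF M h[of s U]] D that by simp
    show "h V (res B U V s) = res J U V (h U s)"
      if "U \<in> carrier X" "V \<in> carrier X" "V \<sqsubseteq> U" "s \<in> sections B U" for U V s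
      by (rule h_eq[OF partial_mapD(4)[OF M h that(2,3)]]) (use D that in simp)
  qed
  have "g \<cdot>\<^bsub>ShX\<^esub> m = f"
  proof (rule sheaf_morphism_eqI[OF Sh_Comp_in_Hom[OF m g] f])
    fix U a assume U: "U \<in> carrier X" and a: "a \<in> sections A U"
    have "(U, component m U a, component f U a) \<in> M" using M0M M0 U a by blast
    then have "h U (component m U a) = component f U a" by (rule h_eq)
    then show "component (g \<cdot>\<^bsub>ShX\<^esub> m) U a = component f U a"
      using component_Comp[OF m U a] component_sheaf_map[OF U component_closed[OF m U a]]
      unfolding g_def by simp
  qed
  then show ?thesis using g by blast
qed

end

section \<open>Injective objects\<close>

text \<open>
  Internal injectivity is carried into \<open>Sh(X)\<close> in the form of \<open>extends_over_epis\<close>; the extension found there is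
  carried back because the equivalence is full and faithful.
\<close>

lemma localic_internally_injective_imp_externally_injective:
  fixes C :: "('o, 'a) category" and \<U> :: "'u set set"
  assumes "elementary_topos C" and "set_universe \<U>" and "localic \<U> C"
    and int: "internally_injective C I"
  shows "externally_injective C I"
proof -
  interpret C: elementary_topos C by fact
  interpret set_universe \<U> by fact
  obtain X :: "'u gorder" where "frame X" and "carrier X \<in> \<U>"
    and eq: "equivalent_categories C (Sh \<U> X)"
    using assms(3) unfolding localic_def by blast
  interpret frame X by fact
  interpret sheaf_topos X \<U> by unfold_locales fact
  obtain F0 F1 where "ff_eso_functor C ShX F0 F1"
    using C.category_axioms Sh_category eq by (rule equivalent_categories_ff_eso)
  then interpret F: ff_eso_functor C ShX F0 F1 .
  have I: "I \<in> Obj C" using int unfolding internally_injective_def by blast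
  have ext: "extends_over_epis ShX (F0 I)"
    by (rule F.transport_extends_over_epis[OF C.internally_injective_extends_over_epis[OF int] I])
  show ?thesis
    unfolding externally_injective_def
  proof (intro conjI allI impI I)
    fix m assume mono: "monomorphism C m"
    define A B where "A = Dom C m" and "B = Cod C m"
    have m: "m \<in> Hom C A B" using mono unfolding monomorphism_def A_def B_def by (simp add: Hom_def)
    have B: "B \<in> Obj C" using m C.Hom_Obj by blast
    have "\<exists>g \<in> Hom C B I. g \<cdot>\<^bsub>C\<^esub> m = f" if f: "f \<in> Hom C A I" for f
    proof -
      obtain g where g: "g \<in> Hom ShX (F0 B) (F0 I)" and gm: "g \<cdot>\<^bsub>ShX\<^esub> F1 m = F1 f"
        using extends_over_epis_imp_extends[OF ext F.F_in_Hom[OF m] F.preserves_mono[OF m mono]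
            F.F_in_Hom[OF f]] by blast
      obtain g' where g': "g' \<in> Hom C B I" "F1 g' = g" using F.full[OF B I g] by blast
      have "g' \<cdot>\<^bsub>C\<^esub> m = f"
        by (rule F.faithful[OF C.Comp_in_Hom[OF m g'(1)] f]) (simp add: F.F_Comp[OF m g'(1)] g'(2) gm)
      then show ?thesis using g'(1) by blast
    qed
    then have "(\<lambda>g. g \<cdot>\<^bsub>C\<^esub> m) ` Hom C B I = Hom C A I"
      using C.Comp_in_Hom[OF m] by (auto simp: image_iff)
    then show "(\<lambda>g. g \<cdot>\<^bsub>C\<^esub> m) ` Hom C (Cod C m) I = Hom C (Dom C m) I"
      unfolding A_def B_def .
  qed
qed

theorem theorem3p8:
  fixes \<E> :: "('o, 'a) category" and I :: 'o and \<U> :: "'u set set"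
  assumes "elementary_topos \<E>" and "I \<in> Obj \<E>"
  shows "(externally_injective \<E> I \<longrightarrow> internally_injective \<E> I) \<and>
    (set_universe \<U> \<and> localic \<U> \<E> \<longrightarrow>
      (internally_injective \<E> I \<longrightarrow> externally_injective \<E> I))"
  using elementary_topos.externally_injective_imp_internally_injective[OF assms(1)]
    localic_internally_injective_imp_externally_injective[OF assms(1)] by blast

end
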